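(* Let $(G,<)$ be an ordered nilpotent group of class $2$ and let $S=\{x_1,x_2,\dots,x_{k-1},x_k\}$ be a subset of $G$ of size $k\geq 4$, with $\langle S\rangle$ non-abelian. Let $T=\{x_1,x_2,\dots,x_{k-1}\}$. Suppose that $\langle T\rangle$ is abelian and $$|S^2| = 3k+i \leq 4k-6$$ for some integer $i$ satisfying $i>-k$. Then there exist $a,b,c\in G$ with $c>1$ such that $$S\subseteq \{a, ac, \dots, ac^{k+i}, b\}\subseteq \{a, ac, \dots, ac^{2k-6}, b\},$$ and either $ab=bac^v$ or $ba=abc^v$ for some $v\in\mathbb{N}$ satisfying $v\leq k+i$.
   Context: An ordered group $(G,<)$ is a group with a total order such that $x<y$ implies $gxh<gyh$ for all $g,h\in G$. For a subset $S$ of a group, $S^2=\{s_1s_2\mid s_1,s_2\in S\}$, and $\langle S\rangle$ is the subgroup generated by $S$. $\mathbb{N}$ denotes the positive integers, and $1$ the identity of $G$. The listing $x_1,\dots,x_k$ of the elements of $S$ is not assumed to be increasing with respect to $<$. *)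

theory Defs
  imports "HOL-Algebra.Algebra"
begin

locale ordered_group = group G for G :: "('a, 'b) monoid_scheme" (structure) +
  fixes less :: "'a \<Rightarrow> 'a \<Rightarrow> bool"  (infix \<open>\<prec>\<close> 50)
  assumes less_irrefl: "irreflp_on (carrier G) (\<prec>)"
    and less_trans: "transp_on (carrier G) (\<prec>)"
    and less_total: "totalp_on (carrier G) (\<prec>)"
    and mult_less_mono:
      "\<lbrakk>x \<in> carrier G; y \<in> carrier G; g \<in> carrier G; h \<in> carrier G; x \<prec> y\<rbrakk>
        \<Longrightarrow> g \<otimes> x \<otimes> h \<prec> g \<otimes> y \<otimes> h"

text \<open>The commutator of \<open>x\<close> and \<open>y\<close> is \<open>x \<otimes> y \<otimes> inv x \<otimes> inv y\<close>, as in \<^const>\<open>derived\<close>. The numbering starts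
  at 0 with the whole group, so that \<open>lower_central G n\<close> is usually written
  \<open>\<gamma>\<^sub>n\<^sub>+\<^sub>1(G)\<close>.\<close>

primrec lower_central :: "('a, 'b) monoid_scheme \<Rightarrow> nat \<Rightarrow> 'a set" where
  "lower_central G 0 = carrier G"
| "lower_central G (Suc n) =
     generate G (\<Union>x \<in> lower_central G n. \<Union>y \<in> carrier G.
       {x \<otimes>\<^bsub>G\<^esub> y \<otimes>\<^bsub>G\<^esub> inv\<^bsub>G\<^esub> x \<otimes>\<^bsub>G\<^esub> inv\<^bsub>G\<^esub> y})"

definition nilpotent_of_class :: "('a, 'b) monoid_scheme \<Rightarrow> nat \<Rightarrow> bool" where
  "nilpotent_of_class G n \<longleftrightarrow>
     lower_central G n = {\<one>\<^bsub>G\<^esub>} \<and> (\<forall>m<n. lower_central G m \<noteq> {\<one>\<^bsub>G\<^esub>})"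

end

theory Submission
  imports Defs "HOL-Library.Set_Algebras"
begin

text \<open>
Write \<open>S = T \<union> {y}\<close> with \<open>T\<close> commuting and \<open>y\<close> not centralising \<open>T\<close>. If \<open>y t\<close> or \<open>t y\<close> were a
product of two elements of \<open>T\<close>, then \<open>y\<close> would lie in the abelian subgroup generated by \<open>T\<close>. If \<open>y y\<close>
were such a product, it would commute with \<open>T\<close>, and so would \<open>y\<close>: in an ordered group roots are unique,
so an element commutes with whatever one of its positive powers commutes with. Hence \<open>S S\<close> is the disjoint union
of \<open>T T\<close>, \<open>yT \<union> Ty\<close> and \<open>{y y}\<close> (\<open>card_set_mult_insert_noncommuting\<close>). The set \<open>T\<close> is not invariant
under conjugation by \<open>y\<close>: in class 2 conjugation multiplies a moved element by a central \<open>z \<noteq> 1\<close>, so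
invariance would put the infinite set of all \<open>t z^n\<close> into \<open>T\<close>. This gives \<open>|yT \<union> Ty| > |T|\<close>
(\<open>card_translates_noncommuting\<close>), and what is left for \<open>T T\<close> is at most \<open>3 |T| - 4\<close> elements.

By Freiman's theorem (\<open>freiman_3k_minus_4\<close>) \<open>T\<close> then lies in a progression \<open>{a c^j | j \<le> N}\<close> with
\<open>N = |T T| - |T| \<le> k + i\<close>. Conversely \<open>|T T| \<ge> 2 |T| - 1\<close> leaves so little room for \<open>yT \<union> Ty\<close> that
\<open>yT\<close> and \<open>Ty\<close> share two elements, that is, there are two relations \<open>y a c^j = a c^l y\<close>. If
\<open>j = l\<close> in both, then \<open>y\<close> commutes with two different terms of the progression, hence with a power of
\<open>c\<close>, hence with \<open>c\<close>, with \<open>a\<close> and with all of \<open>T\<close>, which is excluded. A relation with \<open>j \<noteq> l\<close> shows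
that a nontrivial power of \<open>c\<close> is a commutator. It is central, so \<open>c\<close> is central by uniqueness of
roots, and cancelling powers of \<open>c\<close> turns the relation into the required one between \<open>a\<close> and \<open>y\<close>.

Freiman's theorem is obtained for integers and then transported. For integers the claim is that a set
\<open>{a 0 < \<dots> < a N}\<close> whose differences have no common divisor and with \<open>a N - a 0 \<ge> 2 N\<close> has at least
\<open>3 N\<close> sums (\<open>sparse_doubling_holds\<close>). This is an induction on \<open>N\<close>. Long runs of sums come from the
pigeonhole principle in the part of the set that is dense (\<open>a t < 2 t\<close>), and the remaining sums come
either from the induction hypothesis for a tail of the set or, if the differences in the tail have
a common divisor \<open>d\<close>, from the fact that the set then meets a residue class modulo \<open>d\<close> that the tail
avoids. In a torsion-free abelian group, finitely many prescribed elements can be separated from the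
identity by integer weights on the generators (\<open>ex_separating_weights\<close>). Applied to all short relations
between elements of \<open>T\<close>, this produces a set of integers with the same additive structure
(\<open>ex_integer_model\<close>), from which the progression is pulled back.
\<close>

section \<open>Sums of finite sets of integers\<close>

text \<open>The sums with the least element of one set and those with the greatest element of the other have
only one sum in common.\<close>

lemma card_set_plus_ge:
  fixes B Y :: "int set"
  assumes "finite B" "B \<noteq> {}" "finite Y" "Y \<noteq> {}"
  shows "card B + card Y \<le> card (B + Y) + 1"
proof -
  let ?L = "(\<lambda>x. x + Min Y) ` B" and ?R = "(\<lambda>y. Max B + y) ` Y"
  have "?L \<inter> ?R \<subseteq> {Max B + Min Y}"
  proof
    fix s assume "s \<in> ?L \<inter> ?R"
    then obtain x y where "x \<in> B" "y \<in> Y" "s = x + Min Y" "s = Max B + y" by auto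
    moreover have "x \<le> Max B" "Min Y \<le> y" using assms calculation by auto
    ultimately show "s \<in> {Max B + Min Y}" by auto
  qed
  then have "card (?L \<inter> ?R) \<le> card {Max B + Min Y}" by (intro card_mono) auto
  then have "card (?L \<inter> ?R) \<le> 1" by simp
  moreover have "card ?L = card B" "card ?R = card Y" by (auto intro!: card_image inj_onI)
  moreover have "card ?L + card ?R = card (?L \<union> ?R) + card (?L \<inter> ?R)"
    using assms by (intro card_Un_Int) auto
  moreover have "card (?L \<union> ?R) \<le> card (B + Y)"
  proof (rule card_mono)
    show "finite (B + Y)" using assms by (simp add: finite_set_plus)
    show "?L \<union> ?R \<subseteq> B + Y"
      using Min_in[OF assms(3,4)] Max_in[OF assms(1,2)] by blast
  qed
  ultimately show ?thesis by linarith
qed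

text \<open>\<open>B\<close> and its reflection \<open>s - B\<close> are too large to be disjoint in \<open>{0..s}\<close>.\<close>

lemma mem_set_plus_self_pigeonhole:
  fixes B :: "int set"
  assumes "B \<subseteq> {0..s}" "0 \<le> s" "s + 1 < 2 * int (card B)"
  shows "s \<in> B + B"
proof -
  have fin: "finite B" using assms(1) finite_subset by blast
  let ?Y = "(\<lambda>x. s - x) ` B"
  have "B \<inter> ?Y \<noteq> {}"
  proof
    assume "B \<inter> ?Y = {}"
    then have "card (B \<union> ?Y) = card B + card ?Y" using fin by (intro card_Un_disjoint) auto
    moreover have "card ?Y = card B" by (auto intro!: card_image inj_onI)
    moreover have "B \<union> ?Y \<subseteq> {0..s}" using assms(1) by auto
    then have "card (B \<union> ?Y) \<le> card {0..s}" by (intro card_mono) auto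
    moreover have "int (card {0..s}) = s + 1" using assms(2) by simp
    ultimately show False using assms(3) by linarith
  qed
  then obtain x y where "x \<in> B" "y \<in> B" "x = s - y" by auto
  then show ?thesis using set_plus_intro[of x B y B] by simp
qed

lemma mem_set_plus_self_pigeonhole_mod:
  fixes B :: "int set"
  assumes B: "B \<subseteq> {0..<n}" and n: "n < 2 * int (card B)" and s: "0 \<le> s" "s < n"
  shows "s \<in> B + B \<or> s + n \<in> B + B"
proof -
  have fin: "finite B" using B finite_subset by blast
  let ?Y = "(\<lambda>x. (s - x) mod n) ` B"
  have inj: "inj_on (\<lambda>x. (s - x) mod n) B"
  proof (rule inj_onI)
    fix x y assume xy: "x \<in> B" "y \<in> B" "(s - x) mod n = (s - y) mod n"
    then have "n dvd (s - x) - (s - y)" by (simp add: mod_eq_dvd_iff)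
    then have "n dvd y - x" by simp
    moreover have "\<bar>y - x\<bar> < n" using subsetD[OF B xy(1)] subsetD[OF B xy(2)] by auto
    ultimately show "x = y"
      using dvd_imp_le_int[of "y - x" n] by fastforce
  qed
  have "B \<inter> ?Y \<noteq> {}"
  proof
    assume "B \<inter> ?Y = {}"
    then have "card (B \<union> ?Y) = card B + card ?Y" using fin by (intro card_Un_disjoint) auto
    moreover have "card ?Y = card B" using inj by (rule card_image)
    moreover have "B \<union> ?Y \<subseteq> {0..<n}" using B s by auto
    then have "card (B \<union> ?Y) \<le> card {0..<n}" by (intro card_mono) auto
    moreover have "int (card {0..<n}) = n" using s by simp
    ultimately show False using n by linarith
  qed
  then obtain x y where xy: "x \<in> B" "y \<in> B" "x = (s - y) mod n" by auto
  have y: "0 \<le> y" "y < n" using subsetD[OF B xy(2)] by auto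
  have "x + y = s \<or> x + y = s + n"
  proof (cases "y \<le> s")
    case True
    then have "(s - y) mod n = s - y" using y s by (intro mod_pos_pos_trivial) auto
    then show ?thesis using xy(3) by linarith
  next
    case False
    have "(s - y) mod n = (s - y + n) mod n" by simp
    also have "\<dots> = s - y + n" using False y s by (intro mod_pos_pos_trivial) auto
    finally show ?thesis using xy(3) by linarith
  qed
  then show ?thesis using set_plus_intro[OF xy(1,2)] by metis
qed

text \<open>Every residue modulo \<open>n\<close> is hit by a sum, by pigeonhole. The residues of elements of \<open>A\<close> are hit at
least twice, by \<open>x = 0 + x\<close> and by \<open>n + x\<close>, and the residue \<open>0\<close> is hit by \<open>0\<close>, \<open>n\<close> and \<open>n + n\<close>.\<close>

lemma card_set_plus_self_short:
  fixes A :: "int set"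
  assumes fin: "finite A" and ends: "0 \<in> A" "n \<in> A" and A: "A \<subseteq> {0..n}"
    and short: "n + 3 \<le> 2 * int (card A)"
  shows "int (card A) + n \<le> int (card (A + A))"
proof (cases "n = 0")
  case True
  then have "A = {0}" using A ends by auto
  then show ?thesis using short True by simp
next
  case False
  then have n: "n > 0" using A ends by force
  let ?C = "A - {n}"
  have le: "0 \<le> u \<and> u \<le> n" if "u \<in> A" for u using A that by auto
  have sub: "?C \<subseteq> {0..<n}" using A by force
  have cX: "card A = card ?C + 1" using card.remove[OF fin ends(2)] by simp
  have f: "r \<in> A + A \<or> r + n \<in> A + A" if "0 \<le> r" "r < n" for r
  proof -
    have "r \<in> ?C + ?C \<or> r + n \<in> ?C + ?C"
    proof (rule mem_set_plus_self_pigeonhole_mod)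
      show "?C \<subseteq> {0..<n}" by (rule sub)
      show "n < 2 * int (card ?C)" using short cX by linarith
    qed (use that in auto)
    moreover have "?C + ?C \<subseteq> A + A" by (intro set_plus_mono2) auto
    ultimately show ?thesis by blast
  qed
  \<comment> \<open>One sum for each residue outside \<open>A\<close>, added to the sums \<open>A \<union> (n + A)\<close>.\<close>
  define f where "f r = (if r \<in> A + A then r else r + n)" for r
  let ?F = "f ` ({0..<n} - A)" and ?N = "(\<lambda>x. n + x) ` A"
  have fF: "f r \<in> A + A" "f r = r \<or> f r = r + n" if "r \<in> {0..<n} - A" for r
    using f[of r] that by (auto simp: f_def)
  have cardF: "int (card ?F) = n - int (card ?C)"
  proof -
    have "inj_on f ({0..<n} - A)"
    proof (rule inj_onI)
      fix r s assume rs: "r \<in> {0..<n} - A" "s \<in> {0..<n} - A" "f r = f s"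
      then have "r < n" "s < n" "0 \<le> r" "0 \<le> s" by auto
      then show "r = s" using fF(2)[OF rs(1)] fF(2)[OF rs(2)] rs(3) by auto
    qed
    then have F: "card ?F = card ({0..<n} - A)" by (rule card_image)
    have "{0..<n} - A = {0..<n} - ?C" by auto
    then have "card ({0..<n} - A) = card ({0..<n} - ?C)" by (rule arg_cong)
    also have "\<dots> = card {0..<n} - card ?C"
      using sub fin by (intro card_Diff_subset) auto
    finally have "card ({0..<n} - A) = card {0..<n} - card ?C" .
    moreover have "card ?C \<le> card {0..<n}" using sub by (intro card_mono) auto
    moreover have "int (card {0..<n}) = n" using n by simp
    ultimately show ?thesis using F by linarith
  qed
  have "A \<inter> ?N \<subseteq> {n}"
  proof
    fix u assume "u \<in> A \<inter> ?N"
    then obtain x where "u \<in> A" "x \<in> A" "u = n + x" by auto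
    then show "u \<in> {n}" using le[of u] le[of x] by auto
  qed
  then have "card (A \<inter> ?N) \<le> card {n}" by (intro card_mono) auto
  then have "card (A \<inter> ?N) \<le> 1" by simp
  moreover have "card A + card ?N = card (A \<union> ?N) + card (A \<inter> ?N)"
    using fin by (intro card_Un_Int) auto
  moreover have "card ?N = card A" by (auto intro!: card_image inj_onI)
  moreover have "(A \<union> ?N) \<inter> ?F = {}"
  proof -
    have "f r \<notin> A \<and> f r \<notin> ?N" if r: "r \<in> {0..<n} - A" for r
    proof -
      have r': "0 \<le> r" "r < n" "r \<notin> A" "r \<noteq> 0" using r ends by auto
      have "f r \<notin> A" using fF(2)[OF r] r' le[of "r + n"] by auto
      moreover have "f r \<noteq> n + x" if x: "x \<in> A" for x
      proof -
        have "x \<noteq> r" using x r' by auto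
        then show ?thesis using fF(2)[OF r] r' le[OF x] by linarith
      qed
      ultimately show ?thesis by blast
    qed
    then show ?thesis by (auto simp only: disjoint_iff Un_iff image_iff)
  qed
  then have "card ((A \<union> ?N) \<union> ?F) = card (A \<union> ?N) + card ?F"
    using fin by (intro card_Un_disjoint) auto
  moreover have "card ((A \<union> ?N) \<union> ?F) \<le> card (A + A)"
  proof (rule card_mono)
    show "finite (A + A)" using fin by (simp add: finite_set_plus)
    have "0 + u \<in> A + A" if "u \<in> A" for u using ends(1) that by (rule set_plus_intro)
    then have "A \<subseteq> A + A" by auto
    moreover have "?N \<subseteq> A + A" using ends(2) by blast
    moreover have "?F \<subseteq> A + A" using fF(1) by blast
    ultimately show "A \<union> ?N \<union> ?F \<subseteq> A + A" by blast
  qed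
  ultimately show ?thesis using cardF cX by linarith
qed

section \<open>Sparse sets of integers\<close>

text \<open>Primitive sets are those not contained in a coset of a proper subgroup of the integers. Since \<open>d = 0\<close>
is included, a set with at most one element is not primitive.\<close>

definition primitive :: "int set \<Rightarrow> bool" where
  "primitive A \<longleftrightarrow> (\<forall>d. (\<forall>x\<in>A. \<forall>y\<in>A. d dvd x - y) \<longrightarrow> d dvd 1)"

lemma primitive_mono: "primitive A \<Longrightarrow> A \<subseteq> B \<Longrightarrow> primitive B"
  unfolding primitive_def by (meson subsetD)

text \<open>Split \<open>A\<close> into the part \<open>C\<close> in the residue class of \<open>B\<close> and the rest \<open>A - C\<close>, both nonempty. Then
\<open>C + B\<close> and \<open>(A - C) + B\<close> have no residues in common, and each of them has at least as many elements as
its two summands together, minus one.\<close>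

lemma card_set_plus_residue_class:
  fixes A B :: "int set"
  assumes fin: "finite A" and B: "B \<subseteq> A" "B \<noteq> {}"
    and cls: "\<And>x y. x \<in> B \<Longrightarrow> y \<in> B \<Longrightarrow> d dvd x - y"
    and not_cls: "x0 \<in> A" "y0 \<in> A" "\<not> d dvd x0 - y0"
  shows "card A + 2 * card B \<le> card (A + B) + 2"
proof -
  obtain b where b: "b \<in> B" using B by blast
  define C where "C = {x \<in> A. d dvd x - b}"
  let ?D = "A - C"
  have finB: "finite B" using fin B finite_subset by blast
  have "B \<subseteq> C" using B cls b by (auto simp: C_def)
  then have C: "C \<noteq> {}" "finite C" using B fin by (auto simp: C_def)
  have D: "?D \<noteq> {}" "finite ?D"
  proof -
    show "?D \<noteq> {}"
    proof
      assume "?D = {}"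
      then have "d dvd x0 - b" "d dvd y0 - b" using not_cls by (auto simp: C_def)
      then have "d dvd (x0 - b) - (y0 - b)" by (rule dvd_diff)
      then show False using not_cls by simp
    qed
  qed (use fin in simp)
  have "(C + B) \<inter> (?D + B) = {}"
  proof -
    have False if "c \<in> C" "u \<in> B" "e \<in> ?D" "v \<in> B" "c + u = e + v" for c u e v
    proof -
      have "d dvd c - b" "d dvd u - v" using that cls by (auto simp: C_def)
      then have "d dvd (c - b) + (u - v)" by (rule dvd_add)
      moreover have "(c - b) + (u - v) = e - b" using that by simp
      ultimately show False using that by (auto simp: C_def)
    qed
    then show ?thesis by (auto elim!: set_plus_elim)
  qed
  then have un: "card ((C + B) \<union> (?D + B)) = card (C + B) + card (?D + B)"
    using C D finB by (intro card_Un_disjoint) (auto simp: finite_set_plus)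
  have "(C + B) \<union> (?D + B) = A + B"
  proof -
    have "A = C \<union> ?D" by (auto simp: C_def)
    then show ?thesis by (metis Un_set_plus)
  qed
  then have "card (A + B) = card (C + B) + card (?D + B)" using un by simp
  moreover have "card C + card B \<le> card (C + B) + 1" "card ?D + card B \<le> card (?D + B) + 1"
    using card_set_plus_ge[OF C(2,1) finB B(2)] card_set_plus_ge[OF D(2,1) finB B(2)] by auto
  moreover have "card A = card C + card ?D"
    using fin C by (metis C_def card_Diff_subset card_mono le_add_diff_inverse mem_Collect_eq subsetI)
  ultimately show ?thesis by linarith
qed

text \<open>If the set has more than half of the points of every initial interval, each \<open>s\<close> is a sum by
pigeonhole in \<open>{0..s}\<close>. Beyond the last element \<open>a m\<close> the density stays sufficient up to \<open>2 m\<close>.\<close>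

lemma interval_subset_set_plus_prefix:
  fixes a :: "nat \<Rightarrow> int"
  assumes mono: "strict_mono_on {..m} a" and zero: "a 0 = 0"
    and dense: "\<And>t. 1 \<le> t \<Longrightarrow> t \<le> m \<Longrightarrow> a t < 2 * int t"
  shows "{0..2 * int m} \<subseteq> a ` {..m} + a ` {..m}"
proof
  fix s assume s: "s \<in> {0..2 * int m}"
  define t where "t = Max {t. t \<le> m \<and> a t \<le> s}"
  have "t \<in> {t. t \<le> m \<and> a t \<le> s}" unfolding t_def
    using s zero by (intro Max_in) auto
  then have t: "t \<le> m" "a t \<le> s" by auto
  have tmax: "u \<le> t" if "u \<le> m" "a u \<le> s" for u
    unfolding t_def using that by (intro Max_ge) auto
  have s_le: "s \<le> 2 * int t"
  proof (cases "t = m")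
    case False
    then have "Suc t \<le> m" using t by simp
    moreover have "\<not> a (Suc t) \<le> s" using tmax[of "Suc t"] calculation by auto
    ultimately show ?thesis using dense[of "Suc t"] by simp
  qed (use s in simp)
  have "card (a ` {..t}) = t + 1"
  proof -
    have "inj_on a {..t}"
      using strict_mono_on_imp_inj_on[OF mono] t by (rule_tac inj_on_subset) auto
    then show ?thesis by (simp add: card_image)
  qed
  moreover have "a ` {..t} \<subseteq> {0..s}"
  proof
    fix u assume "u \<in> a ` {..t}"
    then obtain p where "p \<le> t" "u = a p" by auto
    moreover have "a 0 \<le> a p" "a p \<le> a t"
      using calculation t by (auto intro!: strict_mono_on_leD[OF mono])
    ultimately show "u \<in> {0..s}" using zero t by simp
  qed
  ultimately have "s \<in> a ` {..t} + a ` {..t}"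
    using s s_le by (intro mem_set_plus_self_pigeonhole) auto
  moreover have "a ` {..t} + a ` {..t} \<subseteq> a ` {..m} + a ` {..m}"
    using t by (intro set_plus_mono2 image_mono) auto
  ultimately show "s \<in> a ` {..m} + a ` {..m}" by blast
qed

text \<open>Here \<open>i\<close> is the first place where the density drops to one half. The interval \<open>{0..2 (i - 1)}\<close>
consists of sums of the dense prefix, and all sums with a term from the tail \<open>{a i, \<dots>, a N}\<close> lie above
it. As the tail occupies one residue class and the whole set does not, these are numerous enough:
\<open>(2 i - 1) + (N + 1) + 2 (N - i) = 3 N\<close>.\<close>

lemma card_sparse_nonprimitive_tail:
  fixes a :: "nat \<Rightarrow> int"
  assumes mono: "strict_mono_on {..N} a" and zero: "a 0 = 0"
    and prim: "primitive (a ` {..N})"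
    and i: "1 \<le> i" "i \<le> N" "2 * int i \<le> a i"
    and dense: "\<And>t. 1 \<le> t \<Longrightarrow> t < i \<Longrightarrow> a t < 2 * int t"
    and tail: "\<not> primitive (a ` {i..N})"
  shows "3 * N \<le> card (a ` {..N} + a ` {..N})"
proof -
  let ?A = "a ` {..N}" and ?T = "a ` {i..N}" and ?I = "{0..2 * int (i - 1)}"
  have inj: "inj_on a {..N}" by (rule strict_mono_on_imp_inj_on[OF mono])
  have T: "?T \<subseteq> ?A" by auto
  obtain d where d: "\<And>x y. x \<in> ?T \<Longrightarrow> y \<in> ?T \<Longrightarrow> d dvd x - y" and nd: "\<not> d dvd 1"
    using tail unfolding primitive_def by blast
  obtain x0 y0 where xy: "x0 \<in> ?A" "y0 \<in> ?A" "\<not> d dvd x0 - y0"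
    using prim nd unfolding primitive_def by blast
  have "card ?A = N + 1" using inj by (simp add: card_image)
  moreover have "card ?T = N + 1 - i"
    using inj_on_subset[OF inj, of "{i..N}"] by (auto simp: card_image)
  moreover have "card ?A + 2 * card ?T \<le> card (?A + ?T) + 2"
    using T i d xy by (intro card_set_plus_residue_class[where d = d and ?x0.0 = x0 and ?y0.0 = y0]) auto
  moreover have "card ?I = 2 * i - 1" using i by simp
  moreover have "?I \<inter> (?A + ?T) = {}"
  proof -
    have "2 * int i \<le> a p + a q" if "p \<le> N" "i \<le> q" "q \<le> N" for p q
    proof -
      have "a 0 \<le> a p" "a i \<le> a q" using that by (auto intro!: strict_mono_on_leD[OF mono])
      then show ?thesis using zero i by linarith
    qed
    then have "2 * int i \<le> s" if "s \<in> ?A + ?T" for s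
      using that by (auto elim!: set_plus_elim)
    then show ?thesis using i by fastforce
  qed
  then have "card (?I \<union> (?A + ?T)) = card ?I + card (?A + ?T)"
    by (intro card_Un_disjoint) (auto simp: finite_set_plus)
  moreover have "card (?I \<union> (?A + ?T)) \<le> card (?A + ?A)"
  proof (rule card_mono)
    have "strict_mono_on {..i - 1} a" by (rule monotone_on_subset[OF mono]) (use i in auto)
    then have "?I \<subseteq> a ` {..i - 1} + a ` {..i - 1}"
      using zero dense by (rule interval_subset_set_plus_prefix) (use i in auto)
    also have "\<dots> \<subseteq> ?A + ?A" using i by (intro set_plus_mono2 image_mono) auto
    finally show "?I \<union> (?A + ?T) \<subseteq> ?A + ?A" using T by (simp add: set_plus_mono2)
  qed (simp add: finite_set_plus)
  ultimately show ?thesis using i by linarith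
qed

text \<open>This is the induction statement, for sets with \<open>N + 1\<close> elements. The length \<open>2 N\<close> is the least one that
the pigeonhole bound for short sets does not reach.\<close>

definition sparse_doubling :: "nat \<Rightarrow> bool" where
  "sparse_doubling N \<longleftrightarrow> (\<forall>a :: nat \<Rightarrow> int. strict_mono_on {..N} a \<longrightarrow> primitive (a ` {..N})
     \<longrightarrow> 2 * int N \<le> a N - a 0 \<longrightarrow> 3 * N \<le> card (a ` {..N} + a ` {..N}))"

lemma sparse_doubling_tail:
  fixes a :: "nat \<Rightarrow> int"
  assumes "sparse_doubling (N - w)" and w: "w \<le> N" and mono: "strict_mono_on {..N} a"
    and "primitive (a ` {w..N})" and "2 * (int N - int w) \<le> a N - a w"
  shows "3 * (N - w) \<le> card (a ` {w..N} + a ` {w..N})"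
proof -
  let ?b = "\<lambda>t. a (w + t)"
  have im: "?b ` {..N - w} = a ` {w..N}"
  proof -
    have "{w..N} = (\<lambda>t. w + t) ` {..N - w}"
      using w by (simp add: atMost_atLeast0)
    then show ?thesis by (auto simp: image_image)
  qed
  have "strict_mono_on {..N - w} ?b"
    using w by (intro strict_mono_onI strict_mono_onD[OF mono]) auto
  then show ?thesis
    using assms im unfolding sparse_doubling_def by (metis (no_types, lifting) add.right_neutral
        le_add_diff_inverse of_nat_diff)
qed

text \<open>If the set starts with \<open>0, 1\<close>, its density drops to one half first at some index \<open>i = m + 1\<close> with
\<open>m \<ge> 1\<close>. The tail starting at the last dense index \<open>m\<close> is again sparse, because \<open>a m < 2 m\<close>, and it is
shorter. If it is primitive, three groups of sums do not overlap: the interval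
\<open>{0..2 m}\<close>, then the sums \<open>a p + a i\<close> with \<open>p < m\<close>, then the sums of two tail elements other than
\<open>2 a m\<close>. Their number is at least \<open>(2 m + 1) + m + (3 (N - m) - 1) = 3 N\<close>.\<close>

lemma card_sparse_unit_first_gap:
  fixes a :: "nat \<Rightarrow> int"
  assumes IH: "\<And>M. M < N \<Longrightarrow> sparse_doubling M"
    and mono: "strict_mono_on {..N} a" and zero: "a 0 = 0"
    and prim: "primitive (a ` {..N})" and sparse: "2 * int N \<le> a N"
    and N: "1 \<le> N" and one: "a 1 = 1"
  shows "3 * N \<le> card (a ` {..N} + a ` {..N})"
proof -
  let ?A = "a ` {..N}"
  define i where "i = (LEAST t. 1 \<le> t \<and> 2 * int t \<le> a t)"
  have i: "1 \<le> i" "2 * int i \<le> a i"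
    using LeastI[of "\<lambda>t. 1 \<le> t \<and> 2 * int t \<le> a t" N] sparse N unfolding i_def by auto
  have iN: "i \<le> N" unfolding i_def using sparse N by (intro Least_le) auto
  have dense: "a t < 2 * int t" if "1 \<le> t" "t < i" for t
    using not_less_Least[of t "\<lambda>t. 1 \<le> t \<and> 2 * int t \<le> a t"] that unfolding i_def by auto
  have "i \<noteq> 1" using i one by auto
  with i obtain m where m: "i = Suc m" "1 \<le> m" by (cases i) auto
  have le: "a p \<le> a q" if "p \<le> q" "q \<le> N" for p q
    using that by (auto intro!: strict_mono_on_leD[OF mono])
  have lt: "a p < a q" if "p < q" "q \<le> N" for p q
    using that by (auto intro!: strict_mono_onD[OF mono])
  show ?thesis
  proof (cases "primitive (a ` {m..N})")
    case False
    have "\<not> primitive (a ` {i..N})"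
    proof
      assume "primitive (a ` {i..N})"
      then have "primitive (a ` {m..N})"
        using m by (elim primitive_mono) auto
      with False show False ..
    qed
    then show ?thesis using mono zero prim i iN dense by (intro card_sparse_nonprimitive_tail[of N a i]) auto
  next
    case True
    let ?T = "a ` {m..N}"
    \<comment> \<open>The sum \<open>a m + a m\<close> is left out since it may fall into \<open>?I\<close> or \<open>?L\<close>.\<close>
    let ?I = "{0..2 * int m}" and ?L = "(\<lambda>u. u + a i) ` a ` {..<m}"
      and ?R = "(?T + ?T) - {a m + a m}"
    have "3 * (N - m) \<le> card (?T + ?T)"
      using IH m iN mono True sparse dense[of m]
      by (intro sparse_doubling_tail) auto
    moreover have "card ?R = card (?T + ?T) - 1"
    proof -
      have "a m + a m \<in> ?T + ?T" using m iN by (intro set_plus_intro) auto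
      then show ?thesis by (simp add: finite_set_plus)
    qed
    moreover have "card ?L = m"
    proof -
      have "inj_on a {..<m}"
        using strict_mono_on_imp_inj_on[OF mono] m iN by (rule_tac inj_on_subset) auto
      then show ?thesis by (simp add: card_image inj_on_def)
    qed
    moreover have "card ?I = 2 * m + 1" by simp
    moreover have I_lt: "u < a i" if "u \<in> ?I" for u using that i m by simp
    have L_bounds: "a i \<le> u \<and> u < a m + a i" if "u \<in> ?L" for u
    proof -
      obtain p where "p < m" "u = a p + a i" using \<open>u \<in> ?L\<close> by auto
      then show ?thesis using le[of 0 p] lt[of p m] zero m iN by auto
    qed
    have R_ge: "a m + a i \<le> u" if u: "u \<in> ?R" for u
    proof -
      obtain p q where pq: "u = a p + a q" "m \<le> p" "p \<le> N" "m \<le> q" "q \<le> N"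
        using u by (auto elim!: set_plus_elim)
      then have "i \<le> p \<or> i \<le> q" using u m by (cases "p = m"; cases "q = m") auto
      then show ?thesis using le[of m p] le[of m q] le[of i p] le[of i q] pq by auto
    qed
    have dLR: "?L \<inter> ?R = {}" using L_bounds R_ge by fastforce
    have "0 \<le> a m" using le[of 0 m] zero m iN by simp
    have LR_ge: "a i \<le> u" if "u \<in> ?L \<or> u \<in> ?R" for u
      using that
    proof
      assume "u \<in> ?R"
      from R_ge[OF this] show ?thesis using \<open>0 \<le> a m\<close> by linarith
    qed (rule L_bounds[THEN conjunct1])
    have dI: "?I \<inter> (?L \<union> ?R) = {}"
    proof (rule ccontr)
      assume "?I \<inter> (?L \<union> ?R) \<noteq> {}"
      then obtain u where "u \<in> ?I" "u \<in> ?L \<or> u \<in> ?R" by blast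
      from I_lt[OF this(1)] LR_ge[OF this(2)] show False by linarith
    qed
    have "card (?I \<union> (?L \<union> ?R)) = card ?I + (card ?L + card ?R)"
    proof -
      have fin: "finite ?I" "finite ?L" "finite ?R" by (simp_all add: finite_set_plus)
      then show ?thesis
        using card_Un_disjoint[OF _ _ dI] card_Un_disjoint[OF _ _ dLR] by (simp only: finite_Un)
    qed
    moreover have "card (?I \<union> (?L \<union> ?R)) \<le> card (?A + ?A)"
    proof (rule card_mono)
      have "strict_mono_on {..m} a" by (rule monotone_on_subset[OF mono]) (use m iN in auto)
      then have "?I \<subseteq> a ` {..m} + a ` {..m}"
        using zero dense by (rule interval_subset_set_plus_prefix) (use m in auto)
      also have "\<dots> \<subseteq> ?A + ?A" using m iN by (intro set_plus_mono2 image_mono) auto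
      finally have "?I \<subseteq> ?A + ?A" .
      moreover have "?L \<subseteq> ?A + ?A" using m iN by (auto intro!: set_plus_intro)
      moreover have "?T + ?T \<subseteq> ?A + ?A" by (intro set_plus_mono2) auto
      ultimately show "?I \<union> (?L \<union> ?R) \<subseteq> ?A + ?A" by blast
    qed (simp add: finite_set_plus)
    ultimately show ?thesis using m iN by linarith
  qed
qed

text \<open>Removing the least element \<open>0\<close> loses the three sums \<open>0\<close>, \<open>a 1\<close> and \<open>b\<close>, where \<open>b\<close> is the least
element not divisible by \<open>a 1\<close>: a representation of \<open>b\<close> as a sum of two positive elements would consist
of smaller elements, which are multiples of \<open>a 1\<close>. A tail that is not primitive is covered by the
case \<open>i = 1\<close> of \<open>card_sparse_nonprimitive_tail\<close>.\<close>

lemma card_sparse_long_tail: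
  fixes a :: "nat \<Rightarrow> int"
  assumes IH: "\<And>M. M < N \<Longrightarrow> sparse_doubling M"
    and mono: "strict_mono_on {..N} a" and zero: "a 0 = 0"
    and prim: "primitive (a ` {..N})" and N: "1 \<le> N" and two: "2 \<le> a 1"
    and tail: "2 * (int N - 1) \<le> a N - a 1"
  shows "3 * N \<le> card (a ` {..N} + a ` {..N})"
proof (cases "primitive (a ` {1..N})")
  case False
  then show ?thesis
    using mono zero prim N two by (intro card_sparse_nonprimitive_tail[of N a 1]) auto
next
  case True
  let ?A = "a ` {..N}" and ?T = "a ` {1..N}"
  have le: "a p \<le> a q" if "p \<le> q" "q \<le> N" for p q
    using that by (auto intro!: strict_mono_on_leD[OF mono])
  have lt: "a p < a q" if "p < q" "q \<le> N" for p q
    using that by (auto intro!: strict_mono_onD[OF mono])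
  have "3 * (N - 1) \<le> card (?T + ?T)"
    using IH N mono True tail by (intro sparse_doubling_tail) auto
  have "\<not> a 1 dvd 1" using two by (auto simp: zdvd1_eq)
  then have "\<exists>x\<in>?A. \<exists>y\<in>?A. \<not> a 1 dvd x - y" using prim unfolding primitive_def by blast
  then have ex: "\<exists>t. t \<le> N \<and> \<not> a 1 dvd a t" by (auto intro: dvd_diff)
  define t where "t = (LEAST t. t \<le> N \<and> \<not> a 1 dvd a t)"
  have t: "t \<le> N" "\<not> a 1 dvd a t" using LeastI_ex[OF ex] unfolding t_def by auto
  have tleast: "a 1 dvd a p" if "p < t" for p
    using not_less_Least[of p "\<lambda>t. t \<le> N \<and> \<not> a 1 dvd a t"] that t(1) unfolding t_def by auto
  have t1: "t > 1" using t zero by (cases "t = 0"; cases "t = 1") auto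
  have T_ge: "2 * a 1 \<le> u" if u: "u \<in> ?T + ?T" for u
  proof -
    obtain p q where "u = a p + a q" "1 \<le> p" "p \<le> N" "1 \<le> q" "q \<le> N"
      using u by (auto elim!: set_plus_elim)
    then show ?thesis using le[of 1 p] le[of 1 q] by linarith
  qed
  have "a t \<notin> ?T + ?T"
  proof
    assume "a t \<in> ?T + ?T"
    then obtain p q where pq: "a t = a p + a q" "1 \<le> p" "p \<le> N" "1 \<le> q" "q \<le> N"
      by (auto elim!: set_plus_elim)
    have "0 < a p" "0 < a q" using le[of 1 p] le[of 1 q] pq two by auto
    then have "a p < a t" "a q < a t" using pq by auto
    then have "p < t" "q < t" using le[of t p] le[of t q] pq by (auto simp: not_le[symmetric])
    then have "a 1 dvd a p + a q" using tleast by (intro dvd_add) auto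
    then show False using t pq by simp
  qed
  moreover have "0 \<notin> ?T + ?T" "a 1 \<notin> ?T + ?T" using T_ge[of 0] T_ge[of "a 1"] two by auto
  moreover have "a 1 \<noteq> a t" using lt[OF t1 t(1)] by simp
  moreover have "0 \<noteq> a t" using t by auto
  ultimately have "card ({0, a 1, a t} \<union> (?T + ?T)) = 3 + card (?T + ?T)"
    using two by (subst card_Un_disjoint) (auto simp: finite_set_plus)
  moreover have "card ({0, a 1, a t} \<union> (?T + ?T)) \<le> card (?A + ?A)"
  proof (rule card_mono)
    have "0 + u \<in> ?A + ?A" if "u \<in> ?A" for u
      using zero that by (intro set_plus_intro) (auto simp: image_iff intro!: bexI[of _ 0])
    then have "?A \<subseteq> ?A + ?A" by auto
    moreover have "{0, a 1, a t} \<subseteq> ?A" using t N zero by (auto simp: image_iff intro: bexI[of _ 0])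
    moreover have "?T + ?T \<subseteq> ?A + ?A" by (intro set_plus_mono2) auto
    ultimately show "{0, a 1, a t} \<union> (?T + ?T) \<subseteq> ?A + ?A" by blast
  qed (simp add: finite_set_plus)
  ultimately show ?thesis using \<open>3 * (N - 1) \<le> card (?T + ?T)\<close> N by linarith
qed

text \<open>The excess \<open>a t - 2 t\<close> is nonnegative at \<open>t = 1\<close>, negative at \<open>t = N - 1\<close>, and decreases by at most
one at each step. So it passes through \<open>0\<close> and \<open>-1\<close> at consecutive indices \<open>w\<close> and \<open>w + 1\<close>. The prefix
up to \<open>w + 1\<close> is just short enough for the pigeonhole bound, the tail from \<open>w\<close> is sparse and contains
two consecutive integers, and the two sets of sums share at most the three integers from \<open>4 w\<close> to
\<open>4 w + 2\<close>.\<close>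

lemma card_sparse_short_tails:
  fixes a :: "nat \<Rightarrow> int"
  assumes IH: "\<And>M. M < N \<Longrightarrow> sparse_doubling M"
    and mono: "strict_mono_on {..N} a" and zero: "a 0 = 0"
    and sparse: "2 * int N \<le> a N"
    and one: "2 \<le> a 1" "1 < N" and last: "a (N - 1) < 2 * (int N - 1)"
  shows "3 * N \<le> card (a ` {..N} + a ` {..N})"
proof -
  let ?A = "a ` {..N}"
  have le: "a p \<le> a q" if "p \<le> q" "q \<le> N" for p q
    using that by (auto intro!: strict_mono_on_leD[OF mono])
  have lt: "a p < a q" if "p < q" "q \<le> N" for p q
    using that by (auto intro!: strict_mono_onD[OF mono])
  define w where "w = Max {t. t < N \<and> 2 * int t \<le> a t}"
  have "w \<in> {t. t < N \<and> 2 * int t \<le> a t}" unfolding w_def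
    using one by (intro Max_in) auto
  then have w: "w < N" "2 * int w \<le> a w" by auto
  have wmax: "u \<le> w" if "u < N" "2 * int u \<le> a u" for u
    unfolding w_def using that by (intro Max_ge) auto
  have w1: "1 \<le> w" using wmax[of 1] one by simp
  have "w \<noteq> N - 1" using w last by auto
  then have wN: "w + 1 < N" using w by simp
  then have "\<not> 2 * int (w + 1) \<le> a (w + 1)" using wmax[of "w + 1"] by auto
  then have aw: "a w = 2 * int w" "a (w + 1) = 2 * int w + 1"
    using w wN lt[of w "w + 1"] by auto
  let ?P = "a ` {..w + 1}" and ?T = "a ` {w..N}"
  have "int (card ?P) + a (w + 1) \<le> int (card (?P + ?P))"
  proof (rule card_set_plus_self_short)
    show "0 \<in> ?P" using zero by (auto simp: image_iff intro!: bexI[of _ 0])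
    show "?P \<subseteq> {0..a (w + 1)}" using le[of 0] le[of _ "w + 1"] zero wN by auto
    have "inj_on a {..w + 1}"
      using strict_mono_on_imp_inj_on[OF mono] wN by (rule_tac inj_on_subset) auto
    then have "card ?P = w + 2" by (simp add: card_image)
    then show "a (w + 1) + 3 \<le> 2 * int (card ?P)" using aw by simp
  qed auto
  moreover have "card ?P = w + 2"
    using inj_on_subset[OF strict_mono_on_imp_inj_on[OF mono], of "{..w + 1}"] wN
    by (simp add: card_image)
  moreover have "3 * (N - w) \<le> card (?T + ?T)"
  proof (rule sparse_doubling_tail)
    show "primitive ?T" unfolding primitive_def
    proof (intro allI impI)
      fix d assume d: "\<forall>x\<in>?T. \<forall>y\<in>?T. d dvd x - y"
      have "a (w + 1) \<in> ?T" "a w \<in> ?T" using wN by auto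
      then have "d dvd a (w + 1) - a w" using d by blast
      then show "d dvd 1" using aw by simp
    qed
  qed (use IH w1 w mono sparse aw in auto)
  moreover have "(?P + ?P) \<inter> (?T + ?T) \<subseteq> {4 * int w..4 * int w + 2}"
  proof
    fix u assume u: "u \<in> (?P + ?P) \<inter> (?T + ?T)"
    then obtain p q where "u = a p + a q" "p \<le> w + 1" "q \<le> w + 1"
      by (auto elim!: set_plus_elim)
    then have "u \<le> 4 * int w + 2" using le[of p "w + 1"] le[of q "w + 1"] aw wN by simp
    moreover obtain p q where "u = a p + a q" "w \<le> p" "p \<le> N" "w \<le> q" "q \<le> N"
      using u by (auto elim!: set_plus_elim)
    then have "4 * int w \<le> u" using le[of w p] le[of w q] aw by simp
    ultimately show "u \<in> {4 * int w..4 * int w + 2}" by simp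
  qed
  then have "card ((?P + ?P) \<inter> (?T + ?T)) \<le> card {4 * int w..4 * int w + 2}"
    by (intro card_mono) auto
  then have "card ((?P + ?P) \<inter> (?T + ?T)) \<le> 3" by simp
  moreover have "card (?P + ?P) + card (?T + ?T)
      = card ((?P + ?P) \<union> (?T + ?T)) + card ((?P + ?P) \<inter> (?T + ?T))"
    by (intro card_Un_Int) (auto simp: finite_set_plus)
  moreover have "card ((?P + ?P) \<union> (?T + ?T)) \<le> card (?A + ?A)"
  proof (rule card_mono)
    have "?P \<subseteq> ?A" "?T \<subseteq> ?A" using wN by auto
    then have "?P + ?P \<subseteq> ?A + ?A" "?T + ?T \<subseteq> ?A + ?A"
      by (simp_all only: set_plus_mono2)
    then show "(?P + ?P) \<union> (?T + ?T) \<subseteq> ?A + ?A" by blast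
  qed (simp add: finite_set_plus)
  ultimately show ?thesis using aw wN by linarith
qed

text \<open>Used to translate a set so that its least element is \<open>0\<close>, to reflect it, and to divide it by the greatest common
divisor of its differences.\<close>

lemma card_set_plus_affine_image:
  fixes A :: "int set"
  assumes "e \<noteq> 0"
  shows "card ((\<lambda>x. e * x + c) ` A + (\<lambda>x. e * x + c) ` A) = card (A + A)"
proof -
  have "(\<lambda>x. e * x + c) ` A + (\<lambda>x. e * x + c) ` A = (\<lambda>s. e * s + 2 * c) ` (A + A)"
    (is "?L = ?R")
  proof (rule Set.set_eqI)
    fix s
    have "s \<in> ?L \<longleftrightarrow> (\<exists>x\<in>A. \<exists>y\<in>A. s = (e * x + c) + (e * y + c))"
      by (auto simp: set_plus_def)
    also have "\<dots> \<longleftrightarrow> (\<exists>x\<in>A. \<exists>y\<in>A. s = e * (x + y) + 2 * c)"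
      by (simp add: algebra_simps)
    also have "\<dots> \<longleftrightarrow> s \<in> ?R" by (auto simp: set_plus_def)
    finally show "s \<in> ?L \<longleftrightarrow> s \<in> ?R" .
  qed
  moreover have "inj_on (\<lambda>s. e * s + 2 * c) (A + A)" using assms by (auto intro: inj_onI)
  ultimately show ?thesis by (simp add: card_image)
qed

lemma primitive_affine_image:
  assumes "primitive A" "e dvd 1"
  shows "primitive ((\<lambda>x. e * x + c) ` A)"
  unfolding primitive_def
proof (intro allI impI)
  fix d assume d: "\<forall>x\<in>(\<lambda>x. e * x + c) ` A. \<forall>y\<in>(\<lambda>x. e * x + c) ` A. d dvd x - y"
  have "d dvd x - y" if "x \<in> A" "y \<in> A" for x y
  proof -
    have "d dvd (e * x + c) - (e * y + c)" using d that by blast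
    then have "d dvd e * (x - y)" by (simp add: algebra_simps)
    then have "d dvd e * (e * (x - y))" by (rule dvd_mult)
    moreover have "e * e = 1" using assms(2) by (auto simp: abs_if split: if_splits)
    ultimately show ?thesis by (metis mult.assoc mult_1)
  qed
  then show "d dvd 1" using assms(1) unfolding primitive_def by blast
qed

text \<open>The lemmas on a unit first gap, on a long tail and on short tails cover all cases once they may be
applied to the set read from either end.\<close>

theorem sparse_doubling_holds: "sparse_doubling N"
proof (induction N rule: less_induct)
  case (less N)
  show ?case unfolding sparse_doubling_def
  proof (intro allI impI)
    fix a :: "nat \<Rightarrow> int"
    assume mono: "strict_mono_on {..N} a" and prim: "primitive (a ` {..N})"
      and sparse: "2 * int N \<le> a N - a 0"
    show "3 * N \<le> card (a ` {..N} + a ` {..N})"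
    proof (cases "N = 0")
      case False
      then have N: "1 \<le> N" by simp
      \<comment> \<open>\<open>b\<close> is the set read from the left, \<open>c\<close> the set read from the right.\<close>
      define b where "b t = a t - a 0" for t
      define c where "c t = a N - a (N - t)" for t
      have b_im: "b ` {..N} = (\<lambda>x. 1 * x + (- a 0)) ` a ` {..N}"
        by (simp add: b_def image_image)
      have "t \<in> (\<lambda>t. N - t) ` {..N}" if "t \<le> N" for t
        using that by (intro image_eqI[of _ _ "N - t"]) auto
      then have "(\<lambda>t. N - t) ` {..N} = {..N}" by auto
      then have "c ` {..N} = (\<lambda>t. a N - a t) ` {..N}"
        unfolding c_def by (metis (no_types, lifting) image_cong image_image)
      then have c_im: "c ` {..N} = (\<lambda>x. (- 1) * x + a N) ` a ` {..N}"
        by (simp add: image_image)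
      have b: "strict_mono_on {..N} b" "b 0 = 0" "primitive (b ` {..N})"
        "card (b ` {..N} + b ` {..N}) = card (a ` {..N} + a ` {..N})"
      proof -
        show "strict_mono_on {..N} b" "b 0 = 0"
          by (auto simp: b_def intro!: strict_mono_onI strict_mono_onD[OF mono])
        show "primitive (b ` {..N})" unfolding b_im by (rule primitive_affine_image[OF prim]) simp
        show "card (b ` {..N} + b ` {..N}) = card (a ` {..N} + a ` {..N})"
          unfolding b_im by (rule card_set_plus_affine_image) simp
      qed
      have c: "strict_mono_on {..N} c" "c 0 = 0" "primitive (c ` {..N})"
        "card (c ` {..N} + c ` {..N}) = card (a ` {..N} + a ` {..N})"
      proof -
        show "strict_mono_on {..N} c" "c 0 = 0"
          by (auto simp: c_def intro!: strict_mono_onI strict_mono_onD[OF mono])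
        show "primitive (c ` {..N})" unfolding c_im by (rule primitive_affine_image[OF prim]) simp
        show "card (c ` {..N} + c ` {..N}) = card (a ` {..N} + a ` {..N})"
          unfolding c_im by (rule card_set_plus_affine_image) simp
      qed
      have sp: "2 * int N \<le> b N" "2 * int N \<le> c N" using sparse by (simp_all add: b_def c_def)
      have gaps: "1 \<le> b 1" "1 \<le> c 1"
        using strict_mono_onD[OF b(1), of 0 1] strict_mono_onD[OF c(1), of 0 1] b(2) c(2) N by auto
      consider "b 1 = 1" | "c 1 = 1" | "2 \<le> b 1" "2 * (int N - 1) \<le> b N - b 1"
        | "2 \<le> c 1" "2 * (int N - 1) \<le> c N - c 1"
        | "2 \<le> b 1" "b N - b 1 < 2 * (int N - 1)" "c N - c 1 < 2 * (int N - 1)"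
        using gaps by linarith
      then show ?thesis
      proof cases
        case 1
        then show ?thesis
          using card_sparse_unit_first_gap[OF less b(1-3) sp(1) N] b(4) by simp
      next
        case 2
        then show ?thesis
          using card_sparse_unit_first_gap[OF less c(1-3) sp(2) N] c(4) by simp
      next
        case 3
        then show ?thesis
          using card_sparse_long_tail[OF less b(1-3) N] b(4) by simp
      next
        case 4
        then show ?thesis
          using card_sparse_long_tail[OF less c(1-3) N] c(4) by simp
      next
        case 5
        then have "1 < N" using N by (cases "N = 1") auto
        moreover have "b (N - 1) = c N - c 1" using N by (simp add: b_def c_def)
        ultimately show ?thesis
          using card_sparse_short_tails[OF less b(1,2) sp(1)] 5 b(4) by simp
      qed
    qed simp
  qed
qed

section \<open>Freiman's theorem for integers\<close>

text \<open>After division by the greatest common divisor \<open>d\<close> of the differences the set is primitive. Having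
few sums, it is not sparse, so the pigeonhole bound applies and limits its length. The set is even
so dense that it has two elements at distance exactly \<open>d\<close>. These are recorded as \<open>p\<close> and \<open>q\<close>, since
they make the common difference expressible through elements of the set.\<close>

theorem freiman_3k_minus_4_int:
  fixes A :: "int set"
  assumes fin: "finite A" and two: "2 \<le> card A" and small: "card (A + A) + 4 \<le> 3 * card A"
  obtains d p q where "0 < d" "p \<in> A" "q \<in> A" "q - p = d"
    "\<And>x. x \<in> A \<Longrightarrow> \<exists>j. j + card A \<le> card (A + A) \<and> x = Min A + int j * d"
proof -
  define m where "m = Min A"
  have ne: "A \<noteq> {}" using two by auto
  have m: "m \<in> A" "\<And>x. x \<in> A \<Longrightarrow> m \<le> x" using fin ne by (auto simp: m_def)
  define d where "d = Gcd ((\<lambda>x. x - m) ` A)"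
  have d_dvd: "d dvd x - m" if "x \<in> A" for x using that by (auto simp: d_def)
  have "d \<noteq> 0"
  proof
    assume "d = 0"
    then have "A \<subseteq> {m}" using d_dvd by auto
    then have "card A \<le> card {m}" by (intro card_mono) auto
    then show False using two by simp
  qed
  moreover have "0 \<le> d" by (simp add: d_def)
  ultimately have d: "0 < d" by simp
  define B where "B = (\<lambda>x. (x - m) div d) ` A"
  have recover: "d * ((x - m) div d) + m = x" if "x \<in> A" for x using d_dvd[OF that] by simp
  have A_im: "A = (\<lambda>x. d * x + m) ` B"
    unfolding B_def image_image using recover by auto
  have inj: "inj_on (\<lambda>x. d * x + m) B" using d by (auto intro: inj_onI)
  have finB: "finite B" using fin by (simp add: B_def)
  have cards: "card B = card A" "card (B + B) = card (A + A)"
    using d card_image[OF inj] card_set_plus_affine_image[of d m B] A_im by auto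
  have zero: "0 \<in> B" using m(1) by (auto simp: B_def image_iff intro!: bexI[of _ m])
  have nonneg: "0 \<le> x" if "x \<in> B" for x
    using that m(2) d by (auto simp: B_def pos_imp_zdiv_nonneg_iff)
  have prim: "primitive B" unfolding primitive_def
  proof (intro allI impI)
    fix e assume e: "\<forall>x\<in>B. \<forall>y\<in>B. e dvd x - y"
    have "e * d dvd x - m" if "x \<in> A" for x
    proof -
      have "(x - m) div d \<in> B" using that by (auto simp: B_def)
      then have "e dvd (x - m) div d" using e zero by force
      then have "e * d dvd ((x - m) div d) * d" by (rule mult_dvd_mono) simp
      then show ?thesis using d_dvd[OF that] by simp
    qed
    then have "e * d dvd Gcd ((\<lambda>x. x - m) ` A)" by (intro Gcd_greatest) auto
    then have "e * d dvd d" by (simp only: d_def[symmetric])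
    then show "e dvd 1" using d by (metis dvd_times_right_cancel_iff mult_1 less_irrefl)
  qed
  define h where "h i = sorted_list_of_set B ! i" for i
  define N where "N = card B - 1"
  have cB: "card B = N + 1" using two cards(1) by (simp add: N_def)
  then have lessN: "{..<card B} = {..N}" by auto
  have h_mono: "strict_mono_on {..N} h"
    unfolding lessN[symmetric] h_def
    by (auto intro!: strict_mono_onI sorted_wrt_nth_less[OF strict_sorted_list_of_set])
  have h_im: "h ` {..N} = B"
  proof -
    have "B = set (sorted_list_of_set B)" using finB by simp
    also have "\<dots> = h ` {..<card B}" by (auto simp: set_conv_nth h_def)
    finally show ?thesis using lessN by simp
  qed
  have h_le: "h i \<le> h j" if "i \<le> j" "j \<le> N" for i j
    using that by (auto intro!: strict_mono_on_leD[OF h_mono])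
  have B_le: "x \<le> h N" if "x \<in> B" for x using that h_le unfolding h_im[symmetric] by auto
  have h0: "h 0 = 0"
  proof -
    obtain i where "i \<le> N" "h i = 0" using zero unfolding h_im[symmetric] by auto
    moreover have "h 0 \<in> B" unfolding h_im[symmetric] by auto
    ultimately show ?thesis using h_le[of 0 i] nonneg[of "h 0"] by simp
  qed
  have short: "h N < 2 * int N"
  proof (rule ccontr)
    assume "\<not> h N < 2 * int N"
    then have "3 * N \<le> card (B + B)"
      using sparse_doubling_holds[of N] h_mono prim h0 unfolding sparse_doubling_def h_im[symmetric]
      by auto
    then show False using small cB cards by linarith
  qed
  have hN: "h N \<in> B" unfolding h_im[symmetric] by auto
  have size: "int (card B) + h N \<le> int (card (B + B))"
    using finB zero hN nonneg B_le short cB by (intro card_set_plus_self_short) auto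
  \<comment> \<open>Two consecutive elements exist because \<open>B\<close> fills more than half of \<open>{0..h N}\<close>.\<close>
  have "B \<inter> (\<lambda>x. x + 1) ` B \<noteq> {}"
  proof
    assume "B \<inter> (\<lambda>x. x + 1) ` B = {}"
    then have "card (B \<union> (\<lambda>x. x + 1) ` B) = card B + card ((\<lambda>x. x + 1) ` B)"
      using finB by (intro card_Un_disjoint) auto
    moreover have "card ((\<lambda>x. x + 1) ` B) = card B" by (auto intro!: card_image inj_onI)
    moreover have "B \<union> (\<lambda>x. x + 1) ` B \<subseteq> {0..h N + 1}"
    proof
      fix u assume "u \<in> B \<union> (\<lambda>x. x + 1) ` B"
      then obtain v where "v \<in> B" "u = v \<or> u = v + 1" by blast
      then show "u \<in> {0..h N + 1}" using nonneg[of v] B_le[of v] by auto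
    qed
    then have "card (B \<union> (\<lambda>x. x + 1) ` B) \<le> card {0..h N + 1}" by (intro card_mono) auto
    moreover have "int (card {0..h N + 1}) = h N + 2" using nonneg[OF hN] by simp
    ultimately show False using short cB by linarith
  qed
  then obtain r where r: "r \<in> B" "r + 1 \<in> B" by auto
  then have rA: "d * r + m \<in> A" "d * (r + 1) + m \<in> A" by (subst A_im, blast)+
  show ?thesis
  proof (rule that[of d "d * r + m" "d * (r + 1) + m"])
    fix x assume "x \<in> A"
    then obtain y where y: "y \<in> B" "x = d * y + m" using A_im by auto
    have "nat y + card A \<le> card (A + A)"
      using nonneg[OF y(1)] B_le[OF y(1)] size cards by linarith
    moreover have "x = Min A + int (nat y) * d" using y nonneg[OF y(1)] by (simp add: m_def)
    ultimately show "\<exists>j. j + card A \<le> card (A + A) \<and> x = Min A + int j * d" by blast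
  qed (use d rA in \<open>auto simp: algebra_simps\<close>)
qed

section \<open>Integer models in torsion-free abelian groups\<close>

primrec power_product :: "('a, 'b) monoid_scheme \<Rightarrow> (nat \<Rightarrow> 'a) \<Rightarrow> nat \<Rightarrow> (nat \<Rightarrow> int) \<Rightarrow> 'a" where
  "power_product G g 0 z = \<one>\<^bsub>G\<^esub>"
| "power_product G g (Suc r) z = power_product G g r z \<otimes>\<^bsub>G\<^esub> g r [^]\<^bsub>G\<^esub> z r"

definition torsion_free :: "('a, 'b) monoid_scheme \<Rightarrow> bool" where
  "torsion_free G \<longleftrightarrow>
     (\<forall>u\<in>carrier G. \<forall>n :: nat. 0 < n \<longrightarrow> u [^]\<^bsub>G\<^esub> n = \<one>\<^bsub>G\<^esub> \<longrightarrow> u = \<one>\<^bsub>G\<^esub>)"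

context comm_group
begin

lemma power_product_closed [simp]:
  "(\<And>i. i < r \<Longrightarrow> g i \<in> carrier G) \<Longrightarrow> power_product G g r z \<in> carrier G"
  by (induction r) auto

lemma power_product_add:
  "(\<And>i. i < r \<Longrightarrow> g i \<in> carrier G) \<Longrightarrow>
    power_product G g r (\<lambda>i. y i + z i) = power_product G g r y \<otimes> power_product G g r z"
  by (induction r) (simp_all add: int_pow_mult m_ac)

lemma power_product_scale:
  "(\<And>i. i < r \<Longrightarrow> g i \<in> carrier G) \<Longrightarrow>
    power_product G g r (\<lambda>i. n * z i) = power_product G g r z [^] (n :: int)"
  by (induction r) (simp_all add: int_pow_distrib int_pow_pow mult.commute)

lemma power_product_uminus:
  "(\<And>i. i < r \<Longrightarrow> g i \<in> carrier G) \<Longrightarrow>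
    power_product G g r (\<lambda>i. - z i) = inv (power_product G g r z)"
  using power_product_scale[of r g "-1" z] by (simp add: int_pow_neg)

lemma power_product_diff:
  "(\<And>i. i < r \<Longrightarrow> g i \<in> carrier G) \<Longrightarrow>
    power_product G g r (\<lambda>i. y i - z i) = power_product G g r y \<otimes> inv (power_product G g r z)"
  using power_product_add[of r g y "\<lambda>i. - z i"] by (simp add: power_product_uminus)

lemma power_product_unit_vector:
  assumes "\<And>i. i < r \<Longrightarrow> g i \<in> carrier G"
  shows "power_product G g r (\<lambda>i. if i = k then 1 else 0) = (if k < r then g k else \<one>)"
  using assms by (induction r) (auto simp: less_Suc_eq)

lemma int_pow_eq_one_iff:
  assumes "torsion_free G" "u \<in> carrier G" "0 < (n :: int)"
  shows "u [^] n = \<one> \<longleftrightarrow> u = \<one>"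
proof -
  obtain m where m: "0 < m" "n = int m" using zero_less_imp_eq_int[OF assms(3)] by blast
  have "u = \<one>" if "u [^] m = \<one>"
    using assms(1,2) m(1) that unfolding torsion_free_def by blast
  then show ?thesis unfolding m(2) int_pow_int by (metis nat_pow_one)
qed

text \<open>A linear form on exponent vectors is sought that vanishes on all relations between the generators and
does not vanish on the finitely many non-relations in \<open>Z\<close>. It is built one generator at a time. If
some \<open>g r [^] n\<close> with \<open>n > 0\<close> is a product of the earlier generators, then \<open>n\<close>-th powers bring
everything back to the earlier generators, which loses nothing in the absence of torsion. Otherwise no
relation involves \<open>g r\<close>, whose weight is free and is chosen too large to be compensated by the others
on \<open>Z\<close>.\<close>

lemma ex_separating_weights:
  assumes "torsion_free G"
    and "\<And>i. i < r \<Longrightarrow> g i \<in> carrier G" and "finite Z"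
  shows "\<exists>w :: nat \<Rightarrow> int. (\<forall>z. power_product G g r z = \<one> \<longrightarrow> (\<Sum>i<r. w i * z i) = 0) \<and>
    (\<forall>z\<in>Z. (\<Sum>i<r. w i * z i) = 0 \<longrightarrow> power_product G g r z = \<one>)"
  using assms(2,3)
proof (induction r arbitrary: Z)
  case 0
  then show ?case by simp
next
  case (Suc r)
  have gr: "g r \<in> carrier G" and gi: "\<And>i. i < r \<Longrightarrow> g i \<in> carrier G" using Suc.prems(1) by auto
  show ?case
  proof (cases "\<exists>n>0. \<exists>y. g r [^] (n :: int) = power_product G g r y")
    case True
    then obtain n :: int and y where n: "0 < n" "g r [^] n = power_product G g r y" by blast
    \<comment> \<open>\<open>f z\<close> is the exponent vector of the \<open>n\<close>-th power in terms of the earlier generators.\<close>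
    define f where "f z = (\<lambda>i. n * z i + z r * y i)" for z :: "nat \<Rightarrow> int"
    have "power_product G g r (f z) = power_product G g (Suc r) z [^] n" for z
    proof -
      have "power_product G g r (f z) = power_product G g r z [^] n \<otimes> power_product G g r y [^] z r"
        using gi by (simp add: f_def power_product_add power_product_scale)
      also have "power_product G g r y [^] z r = (g r [^] z r) [^] n"
        using gr by (simp add: n(2)[symmetric] int_pow_pow mult.commute)
      finally show ?thesis using gi gr by (simp add: int_pow_distrib)
    qed
    then have one_iff: "power_product G g r (f z) = \<one> \<longleftrightarrow> power_product G g (Suc r) z = \<one>" for z
      using int_pow_eq_one_iff[OF assms(1) _ n(1)] Suc.prems(1) by (metis power_product_closed)
    obtain w where w: "\<And>z. power_product G g r z = \<one> \<Longrightarrow> (\<Sum>i<r. w i * z i) = 0"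
      "\<And>z. z \<in> f ` Z \<Longrightarrow> (\<Sum>i<r. w i * z i) = 0 \<Longrightarrow> power_product G g r z = \<one>"
      using Suc.IH[OF gi finite_imageI[OF Suc.prems(2)], of f] by blast
    define w' where "w' i = (if i < r then n * w i else (\<Sum>i<r. w i * y i))" for i
    have "(\<Sum>i<Suc r. w' i * z i) = (\<Sum>i<r. w i * f z i)" for z
      by (simp add: w'_def f_def algebra_simps sum.distrib sum_distrib_left)
    note sum' = this
    show ?thesis
    proof (intro exI[of _ w'] conjI allI ballI impI)
      fix z assume "power_product G g (Suc r) z = \<one>"
      then show "(\<Sum>i<Suc r. w' i * z i) = 0" unfolding sum' one_iff[symmetric] by (rule w(1))
    next
      fix z assume "z \<in> Z" "(\<Sum>i<Suc r. w' i * z i) = 0"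
      then show "power_product G g (Suc r) z = \<one>"
        unfolding sum' one_iff[symmetric] by (intro w(2)) auto
    qed
  next
    case False
    have last0: "z r = 0" if "power_product G g (Suc r) z = \<one>" for z
    proof (rule ccontr)
      assume nz: "z r \<noteq> 0"
      have "power_product G g r z \<otimes> g r [^] z r = \<one>" using that by simp
      then have eq: "g r [^] z r = inv (power_product G g r z)" 
        using gi gr by (metis inv_comm inv_equality int_pow_closed power_product_closed)
      show False
      proof (cases "0 < z r")
        case True
        moreover have "g r [^] z r = power_product G g r (\<lambda>i. - z i)"
          using eq power_product_uminus[of r g z] gi by simp
        ultimately show False using False by blast
      next
        case neg: False
        have "g r [^] (- z r) = power_product G g r z"
          using eq gi gr by (simp add: int_pow_neg)
        moreover have "0 < - z r" using neg nz by simp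
        ultimately show False using False by blast
      qed
    qed
    obtain w where w: "\<And>z. power_product G g r z = \<one> \<Longrightarrow> (\<Sum>i<r. w i * z i) = 0"
      "\<And>z. z \<in> Z \<Longrightarrow> (\<Sum>i<r. w i * z i) = 0 \<Longrightarrow> power_product G g r z = \<one>"
      using Suc.IH[OF gi Suc.prems(2)] by blast
    \<comment> \<open>\<open>M\<close> exceeds the value of the earlier weights on every vector in \<open>Z\<close>.\<close>
    define M where "M = 1 + (\<Sum>z\<in>Z. \<bar>\<Sum>i<r. w i * z i\<bar>)"
    define w' where "w' i = (if i < r then w i else M)" for i
    have sum': "(\<Sum>i<Suc r. w' i * z i) = (\<Sum>i<r. w i * z i) + M * z r" for z
      by (simp add: w'_def)
    show ?thesis
    proof (intro exI[of _ w'] conjI allI ballI impI)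
      fix z assume z: "power_product G g (Suc r) z = \<one>"
      then have "z r = 0" by (rule last0)
      then show "(\<Sum>i<Suc r. w' i * z i) = 0" unfolding sum' using z w(1)[of z] gi by simp
    next
      fix z assume z: "z \<in> Z" and "(\<Sum>i<Suc r. w' i * z i) = 0"
      then have eq: "(\<Sum>i<r. w i * z i) + M * z r = 0" by (simp only: sum')
      have lt: "\<bar>\<Sum>i<r. w i * z i\<bar> < M"
        using member_le_sum[OF z, of "\<lambda>z. \<bar>\<Sum>i<r. w i * z i\<bar>"] Suc.prems(2) by (simp add: M_def)
      have "z r = 0"
      proof (rule ccontr)
        assume "z r \<noteq> 0"
        then have "M * 1 \<le> \<bar>M\<bar> * \<bar>z r\<bar>" using lt by (intro mult_mono) auto
        also have "\<dots> = \<bar>\<Sum>i<r. w i * z i\<bar>" using eq by (simp add: abs_mult[symmetric])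
        finally show False using lt by simp
      qed
      then show "power_product G g (Suc r) z = \<one>" using eq w(2)[OF z] gi by simp
    qed
  qed
qed

text \<open>Separating weights for the elements of \<open>T\<close>, applied to the exponent vectors of the elements
\<open>t s\<inverse> (q p\<inverse>)^(- j)\<close>. The relations with \<open>j = 1\<close> decide which products of two elements coincide, so the
image has the same number of sums. The larger exponents are needed to recognise in the group that the
image lies in a progression.\<close>

lemma ex_integer_model:
  assumes tf: "torsion_free G" and T: "T \<subseteq> carrier G" "finite T"
  shows "\<exists>f :: 'a \<Rightarrow> int. inj_on f T \<and> card (f ` T + f ` T) = card (T <#> T) \<and>
    (\<forall>s\<in>T. \<forall>t\<in>T. \<forall>p\<in>T. \<forall>q\<in>T. \<forall>j\<le>b :: nat.
       f t - f s = int j * (f q - f p) \<longrightarrow> t = s \<otimes> (q \<otimes> inv p) [^] j)"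
proof -
  define r where "r = card T"
  obtain g where g: "bij_betw g {..<r} T"
    using ex_bij_betw_nat_finite[OF T(2)] by (auto simp: r_def atLeast0LessThan)
  have gT: "\<And>i. i < r \<Longrightarrow> g i \<in> T" using g by (auto simp: bij_betw_def)
  then have gi: "\<And>i. i < r \<Longrightarrow> g i \<in> carrier G" using T by auto
  define e where "e k = (\<lambda>i. if i = k then 1 else 0 :: int)" for k :: nat
  have pe: "power_product G g r (e k) = g k" if "k < r" for k
    using power_product_unit_vector[of r g k] gi that by (simp add: e_def)
  define dif where "dif p q = (\<lambda>i. e q i - e p i)" for p q
  define rel where "rel = (\<lambda>(s, t, p, q, j :: nat). \<lambda>i. dif s t i - int j * dif p q i)"
  \<comment> \<open>The bound \<open>max 1 b\<close> keeps the case \<open>j = 1\<close>, which the count of the sums relies on, also for \<open>b = 0\<close>.\<close>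
  define Z where "Z = rel ` ({..<r} \<times> {..<r} \<times> {..<r} \<times> {..<r} \<times> {..max 1 b})"
  have "finite Z" by (simp add: Z_def)
  from ex_separating_weights[OF tf gi this] obtain w :: "nat \<Rightarrow> int"
    where w: "(\<forall>z. power_product G g r z = \<one> \<longrightarrow> (\<Sum>i<r. w i * z i) = 0) \<and>
      (\<forall>z\<in>Z. (\<Sum>i<r. w i * z i) = 0 \<longrightarrow> power_product G g r z = \<one>)" ..
  have we: "(\<Sum>i<r. w i * e k i) = w k" if "k < r" for k
    using that by (simp add: e_def if_distrib cong: if_cong)
  have wrel: "(\<Sum>i<r. w i * rel (s, t, p, q, j) i) = (w t - w s) - int j * (w q - w p)"
    if "s < r" "t < r" "p < r" "q < r" for s t p q j
  proof -
    have "(\<Sum>i<r. w i * rel (s, t, p, q, j) i) = (\<Sum>i<r. (w i * e t i - w i * e s i)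
        - int j * (w i * e q i - w i * e p i))"
      by (simp add: rel_def dif_def algebra_simps)
    also have "\<dots> = (w t - w s) - int j * (w q - w p)"
      using that by (simp add: sum_subtractf sum_distrib_left[symmetric] we)
    finally show ?thesis .
  qed
  have prel: "power_product G g r (rel (s, t, p, q, j))
      = (g t \<otimes> inv g s) \<otimes> inv ((g q \<otimes> inv g p) [^] j)"
    if "s < r" "t < r" "p < r" "q < r" for s t p q j
    using that gi by (simp add: rel_def dif_def power_product_diff power_product_scale pe int_pow_int)
  have key: "w t - w s = int j * (w q - w p) \<longleftrightarrow> g t \<otimes> inv g s = (g q \<otimes> inv g p) [^] j"
    if "s < r" "t < r" "p < r" "q < r" "j \<le> max 1 b" for s t p q j
  proof -
    have "rel (s, t, p, q, j) \<in> Z" using that by (auto simp: Z_def)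
    then have "(\<Sum>i<r. w i * rel (s, t, p, q, j) i) = 0
        \<longleftrightarrow> power_product G g r (rel (s, t, p, q, j)) = \<one>" using w by blast
    moreover have "u \<otimes> inv v = \<one> \<longleftrightarrow> u = v" if "u \<in> carrier G" "v \<in> carrier G" for u v
      using inv_solve_right'[of \<one> u v] that by simp
    ultimately show ?thesis using that gi by (simp add: wrel prel)
  qed
  define f where "f t = w (inv_into {..<r} g t)" for t
  have idx: "\<exists>k<r. t = g k \<and> f t = w k" if "t \<in> T" for t
  proof -
    have "inv_into {..<r} g t < r" "g (inv_into {..<r} g t) = t"
      using that g inv_into_into[of t g "{..<r}"] f_inv_into_f[of t g "{..<r}"]
      by (auto simp: bij_betw_def)
    then show ?thesis by (auto simp: f_def)
  qed
  have f_key: "f t - f s = int j * (f q - f p) \<longleftrightarrow> t = s \<otimes> (q \<otimes> inv p) [^] j"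
    if mem: "s \<in> T" "t \<in> T" "p \<in> T" "q \<in> T" "j \<le> max 1 b" for s t p q j
  proof -
    obtain s' t' p' q' where "s' < r" "s = g s'" "f s = w s'" "t' < r" "t = g t'" "f t = w t'"
      "p' < r" "p = g p'" "f p = w p'" "q' < r" "q = g q'" "f q = w q'"
      using idx[OF mem(1)] idx[OF mem(2)] idx[OF mem(3)] idx[OF mem(4)] by blast
    then have "f t - f s = int j * (f q - f p) \<longleftrightarrow> t \<otimes> inv s = (q \<otimes> inv p) [^] j"
      using key[of s' t' p' q' j] mem(5) by simp
    also have "\<dots> \<longleftrightarrow> t = s \<otimes> (q \<otimes> inv p) [^] j"
    proof -
      have c: "t \<in> carrier G" "s \<in> carrier G" "(q \<otimes> inv p) [^] j \<in> carrier G" using mem T by auto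
      show ?thesis using inv_solve_right'[OF c(3,1,2)] m_comm[OF c(2,3)] by simp
    qed
    finally show ?thesis .
  qed
  have "inj_on f T"
  proof (rule inj_onI)
    fix s t assume st: "s \<in> T" "t \<in> T" "f s = f t"
    then show "s = t" using f_key[of s t s s 0] T by auto
  qed
  moreover have "card (f ` T + f ` T) = card (T <#> T)"
  proof -
    have sum_iff: "f s + f t = f p + f q \<longleftrightarrow> s \<otimes> t = p \<otimes> q"
      if "s \<in> T" "t \<in> T" "p \<in> T" "q \<in> T" for s t p q
    proof -
      have c: "s \<in> carrier G" "t \<in> carrier G" "p \<in> carrier G" "q \<in> carrier G" using that T by auto
      have "f s + f t = f p + f q \<longleftrightarrow> f t - f p = int 1 * (f q - f s)" by auto
      also have "\<dots> \<longleftrightarrow> t = p \<otimes> (q \<otimes> inv s)" using f_key[of p t s q 1] that c by simp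
      also have "\<dots> \<longleftrightarrow> s \<otimes> t = p \<otimes> q"
      proof -
        have "p \<otimes> (q \<otimes> inv s) = p \<otimes> q \<otimes> inv s" using c by (simp add: m_assoc)
        then have "t = p \<otimes> (q \<otimes> inv s) \<longleftrightarrow> p \<otimes> q = t \<otimes> s" using inv_solve_right[of t "p \<otimes> q" s] c by simp
        then show ?thesis using m_comm[OF c(1,2)] by auto
      qed
      finally show ?thesis .
    qed
    \<comment> \<open>\<open>h\<close> sends the sum \<open>f s + f t\<close> to the product \<open>s \<otimes> t\<close>.\<close>
    define h where "h u = (SOME v. \<exists>s\<in>T. \<exists>t\<in>T. u = f s + f t \<and> v = s \<otimes> t)" for u
    have h: "h (f s + f t) = s \<otimes> t" if "s \<in> T" "t \<in> T" for s t
      unfolding h_def using that sum_iff by (intro some_equality) auto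
    have "bij_betw h (f ` T + f ` T) (T <#> T)" unfolding bij_betw_def
    proof
      show "inj_on h (f ` T + f ` T)"
      proof (rule inj_onI)
        fix u v assume "u \<in> f ` T + f ` T" "v \<in> f ` T + f ` T" "h u = h v"
        then obtain s t p q where "s \<in> T" "t \<in> T" "p \<in> T" "q \<in> T" "u = f s + f t" "v = f p + f q"
          by (auto simp: set_plus_def)
        then show "u = v" using \<open>h u = h v\<close> h sum_iff by simp
      qed
      show "h ` (f ` T + f ` T) = T <#> T"
      proof (intro subset_antisym subsetI)
        fix v assume "v \<in> h ` (f ` T + f ` T)"
        then obtain s t where "s \<in> T" "t \<in> T" "v = h (f s + f t)" by (auto simp: set_plus_def)
        then show "v \<in> T <#> T" using h by (auto simp: set_mult_def)
      next
        fix v assume "v \<in> T <#> T"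
        then obtain s t where st: "s \<in> T" "t \<in> T" "v = h (f s + f t)"
          using h by (fastforce simp: set_mult_def)
        then have "f s + f t \<in> f ` T + f ` T" by (intro set_plus_intro) auto
        then show "v \<in> h ` (f ` T + f ` T)" using st by blast
      qed
    qed
    then show ?thesis by (rule bij_betw_same_card)
  qed
  ultimately show ?thesis using f_key by (intro exI[of _ f]) auto
qed

lemma card_set_mult_self_ge:
  assumes "torsion_free G" and T: "T \<subseteq> carrier G" "finite T" "T \<noteq> {}"
  shows "2 * card T \<le> card (T <#> T) + 1"
proof -
  obtain f :: "'a \<Rightarrow> int" where f: "inj_on f T" "card (f ` T + f ` T) = card (T <#> T)"
    using ex_integer_model[OF assms(1,2,3)] by blast
  have "card (f ` T) = card T" using f by (simp add: card_image)
  moreover have "card (f ` T) + card (f ` T) \<le> card (f ` T + f ` T) + 1"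
    using T by (intro card_set_plus_ge) auto
  ultimately show ?thesis using f by linarith
qed

text \<open>The integer model of \<open>T\<close> lies in a progression whose difference is \<open>f q' - f p'\<close> for two elements
of \<open>T\<close>. As the exponents are at most \<open>|T T|\<close>, the model reflects the corresponding relations, and
\<open>q' p'\<inverse>\<close> is the ratio of the progression in the group.\<close>

theorem freiman_3k_minus_4:
  assumes "torsion_free G" and T: "T \<subseteq> carrier G" "finite T" "2 \<le> card T"
    and small: "card (T <#> T) + 4 \<le> 3 * card T"
  obtains a c where "a \<in> T" "c \<in> carrier G"
    "\<And>t. t \<in> T \<Longrightarrow> \<exists>j :: nat. j + card T \<le> card (T <#> T) \<and> t = a \<otimes> c [^] j"
proof -
  obtain f :: "'a \<Rightarrow> int" where f: "inj_on f T" "card (f ` T + f ` T) = card (T <#> T)"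
    "\<And>s t p q j. s \<in> T \<Longrightarrow> t \<in> T \<Longrightarrow> p \<in> T \<Longrightarrow> q \<in> T \<Longrightarrow> j \<le> card (T <#> T) \<Longrightarrow>
       f t - f s = int j * (f q - f p) \<Longrightarrow> t = s \<otimes> (q \<otimes> inv p) [^] j"
    using ex_integer_model[OF assms(1,2,3), of "card (T <#> T)"] by blast
  have cf: "card (f ` T) = card T" using f by (simp add: card_image)
  have "finite (f ` T)" "2 \<le> card (f ` T)" "card (f ` T + f ` T) + 4 \<le> 3 * card (f ` T)"
    using T small cf f(2) by simp_all
  from freiman_3k_minus_4_int[OF this] obtain d p q
    where dpq': "p \<in> f ` T" "q \<in> f ` T" "q - p = d"
      "\<And>x. x \<in> f ` T \<Longrightarrow>
         \<exists>j. j + card (f ` T) \<le> card (f ` T + f ` T) \<and> x = Min (f ` T) + int j * d"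
    by metis
  note dpq = dpq'[unfolded cf f(2)]
  obtain p' q' where pq: "p' \<in> T" "q' \<in> T" "f p' = p" "f q' = q" using dpq by auto
  have "Min (f ` T) \<in> f ` T" using T by (intro Min_in) auto
  then obtain a where a: "a \<in> T" "f a = Min (f ` T)" by auto
  show ?thesis
  proof (rule that[of a "q' \<otimes> inv p'"])
    fix t assume t: "t \<in> T"
    then obtain j where j: "j + card T \<le> card (T <#> T)" "f t = Min (f ` T) + int j * d"
      using dpq(4)[of "f t"] by auto
    have "t = a \<otimes> (q' \<otimes> inv p') [^] j"
      using t a pq j dpq(3) by (intro f(3)) auto
    then show "\<exists>j :: nat. j + card T \<le> card (T <#> T) \<and> t = a \<otimes> (q' \<otimes> inv p') [^] j"
      using j by blast
  qed (use a pq T in auto)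
qed

end

section \<open>Commutation and roots\<close>

context group
begin

lemma commutes_mult:
  assumes "u \<in> carrier G" "v \<in> carrier G" "t \<in> carrier G" "u \<otimes> t = t \<otimes> u" "v \<otimes> t = t \<otimes> v"
  shows "(u \<otimes> v) \<otimes> t = t \<otimes> (u \<otimes> v)"
proof -
  have "(u \<otimes> v) \<otimes> t = u \<otimes> (t \<otimes> v)" using assms by (simp add: m_assoc)
  also have "\<dots> = (u \<otimes> t) \<otimes> v" using assms m_assoc[of u t v] by simp
  also have "\<dots> = t \<otimes> (u \<otimes> v)" using assms(1-4) by (simp add: m_assoc)
  finally show ?thesis .
qed

lemma commutes_inv:
  assumes "u \<in> carrier G" "t \<in> carrier G" "u \<otimes> t = t \<otimes> u"
  shows "inv u \<otimes> t = t \<otimes> inv u"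
proof -
  have "t = inv u \<otimes> (t \<otimes> u)" using assms inv_solve_left[of t u "t \<otimes> u"] by simp
  then have "t = (inv u \<otimes> t) \<otimes> u" using assms by (simp add: m_assoc)
  then show ?thesis using assms inv_solve_right[of "inv u \<otimes> t" t u] by simp
qed

lemma commutes_pow:
  fixes n :: nat
  assumes "u \<in> carrier G" "t \<in> carrier G" "u \<otimes> t = t \<otimes> u"
  shows "u [^] n \<otimes> t = t \<otimes> u [^] n"
  using assms by (induction n) (simp_all add: commutes_mult)

lemma commutes_generate:
  assumes "u \<in> generate G S" "S \<subseteq> carrier G" "v \<in> carrier G" "\<And>s. s \<in> S \<Longrightarrow> s \<otimes> v = v \<otimes> s"
  shows "u \<otimes> v = v \<otimes> u"
  using assms
proof (induction u rule: generate.induct)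
  case (inv h)
  then show ?case by (intro commutes_inv) auto
next
  case (eng h1 h2)
  then show ?case by (intro commutes_mult) (auto intro: generate_in_carrier)
qed auto

lemma comm_group_subgroup_generated:
  assumes S: "S \<subseteq> carrier G" and comm: "\<And>s t. s \<in> S \<Longrightarrow> t \<in> S \<Longrightarrow> s \<otimes> t = t \<otimes> s"
  shows "comm_group (subgroup_generated G S)"
proof (rule group.group_comm_groupI)
  have car: "carrier (subgroup_generated G S) = generate G S"
    using S by (simp add: carrier_subgroup_generated Int_absorb1)
  fix u v assume "u \<in> carrier (subgroup_generated G S)" "v \<in> carrier (subgroup_generated G S)"
  then have u: "u \<in> generate G S" and v: "v \<in> generate G S" using car by auto
  have "s \<otimes> v = v \<otimes> s" if "s \<in> S" for s
    using commutes_generate[OF v S, of s] that S comm by auto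
  then have "u \<otimes> v = v \<otimes> u" using commutes_generate[OF u S] generate_in_carrier[OF S v] by auto
  then show "u \<otimes>\<^bsub>subgroup_generated G S\<^esub> v = v \<otimes>\<^bsub>subgroup_generated G S\<^esub> u" by simp
qed simp

text \<open>A commutator lies in the second term of the lower central series, so its own commutators lie in the
third term, which is trivial.\<close>

lemma commutator_central_of_class_2:
  assumes "nilpotent_of_class G 2" "u \<in> carrier G" "v \<in> carrier G" "w \<in> carrier G"
  shows "(u \<otimes> v \<otimes> inv u \<otimes> inv v) \<otimes> w = w \<otimes> (u \<otimes> v \<otimes> inv u \<otimes> inv v)"
proof -
  let ?z = "u \<otimes> v \<otimes> inv u \<otimes> inv v"
  have z: "?z \<in> carrier G" using assms by simp
  have "?z \<in> lower_central G 1"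
    using assms(2,3) by (auto intro!: generate.incl)
  then have "?z \<otimes> w \<otimes> inv ?z \<otimes> inv w \<in> lower_central G 2"
    using assms(4) by (auto simp: numeral_2_eq_2 intro!: generate.incl)
  then have "?z \<otimes> w \<otimes> inv ?z \<otimes> inv w = \<one>"
    using assms(1) by (simp add: nilpotent_of_class_def)
  then have "?z \<otimes> w \<otimes> inv ?z = w"
    using inv_solve_right'[of \<one> "?z \<otimes> w \<otimes> inv ?z" w] z assms(4) by simp
  then show ?thesis using inv_solve_right'[of w "?z \<otimes> w" ?z] z assms(4) by simp
qed

end

context ordered_group
begin

lemma mult_left_less: "less x y \<Longrightarrow> x \<in> carrier G \<Longrightarrow> y \<in> carrier G \<Longrightarrow> g \<in> carrier G \<Longrightarrow> less (g \<otimes> x) (g \<otimes> y)"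
  using mult_less_mono[of x y g \<one>] by simp

lemma mult_right_less: "less x y \<Longrightarrow> x \<in> carrier G \<Longrightarrow> y \<in> carrier G \<Longrightarrow> g \<in> carrier G \<Longrightarrow> less (x \<otimes> g) (y \<otimes> g)"
  using mult_less_mono[of x y \<one> g] by simp

lemma pow_less:
  assumes "less x y" "x \<in> carrier G" "y \<in> carrier G"
  shows "less (x [^] Suc n) (y [^] Suc n)"
proof (induction n)
  case 0
  then show ?case using assms by simp
next
  case (Suc n)
  have "less (x [^] Suc n \<otimes> x) (x [^] Suc n \<otimes> y)"
    by (intro mult_left_less nat_pow_closed assms)
  moreover have "less (x [^] Suc n \<otimes> y) (y [^] Suc n \<otimes> y)"
    by (intro mult_right_less nat_pow_closed assms Suc.IH)
  ultimately have "less (x [^] Suc n \<otimes> x) (y [^] Suc n \<otimes> y)"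
    using transp_onD[OF less_trans] assms by (meson m_closed nat_pow_closed)
  then show ?case by simp
qed

lemma pow_left_cancel:
  fixes n :: nat
  assumes "x [^] n = y [^] n" "0 < n" "x \<in> carrier G" "y \<in> carrier G"
  shows "x = y"
proof (rule ccontr)
  assume "x \<noteq> y"
  then have "less x y \<or> less y x" using totalp_onD[OF less_total] assms by blast
  moreover obtain m where m: "n = Suc m" using assms(2) by (cases n) auto
  ultimately have "less (x [^] n) (y [^] n) \<or> less (y [^] n) (x [^] n)"
    unfolding m using pow_less assms(3,4) by blast
  then show False using irreflp_onD[OF less_irrefl] assms by (metis nat_pow_closed)
qed

lemma torsion_free_carrier: "torsion_free G"
  unfolding torsion_free_def using pow_left_cancel[of _ _ \<one>] by auto

text \<open>Conjugating \<open>u\<close> by \<open>y\<close> gives another root of \<open>u [^] n\<close>, and roots are unique.\<close>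

lemma root_commutes:
  fixes n :: nat
  assumes "u [^] n \<otimes> y = y \<otimes> u [^] n" "0 < n" and c: "u \<in> carrier G" "y \<in> carrier G"
  shows "u \<otimes> y = y \<otimes> u"
proof -
  have conj_pow: "(inv y \<otimes> u \<otimes> y) [^] m = inv y \<otimes> u [^] m \<otimes> y" for m :: nat
  proof (induction m)
    case 0
    then show ?case using c by simp
  next
    case (Suc m)
    have "(inv y \<otimes> u \<otimes> y) [^] Suc m = (inv y \<otimes> u [^] m \<otimes> y) \<otimes> (inv y \<otimes> u \<otimes> y)"
      using Suc by simp
    also have "\<dots> = inv y \<otimes> u [^] m \<otimes> (y \<otimes> inv y) \<otimes> u \<otimes> y"
      using c by (simp add: m_assoc del: r_inv Units_r_inv)
    also have "\<dots> = inv y \<otimes> u [^] Suc m \<otimes> y" using c by (simp add: m_assoc)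
    finally show ?case .
  qed
  have "inv y \<otimes> u [^] n \<otimes> y = inv y \<otimes> (y \<otimes> u [^] n)" using assms by (simp add: m_assoc)
  also have "\<dots> = u [^] n" using c inv_solve_left'[of "u [^] n" y "y \<otimes> u [^] n"] by simp
  finally have "(inv y \<otimes> u \<otimes> y) [^] n = u [^] n" by (simp add: conj_pow)
  then have "inv y \<otimes> u \<otimes> y = u" using c by (rule_tac pow_left_cancel[OF _ assms(2)]) auto
  then have "inv y \<otimes> (u \<otimes> y) = u" using c by (simp add: m_assoc)
  then show ?thesis using inv_solve_left'[of u y "u \<otimes> y"] c by simp
qed

lemma pow_inj:
  fixes m n :: nat
  assumes "z [^] m = z [^] n" "z \<in> carrier G" "z \<noteq> \<one>"
  shows "m = n"
proof (rule ccontr)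
  assume "m \<noteq> n"
  then have "0 < m - n \<or> 0 < n - m" by auto
  moreover have "z [^] (m - n) = \<one>" "z [^] (n - m) = \<one>"
    using pow_eq_div2[of z m n] pow_eq_div2[of z n m] assms by auto
  ultimately show False using torsion_free_carrier assms unfolding torsion_free_def by blast
qed

section \<open>An abelian set with one more element\<close>

text \<open>The parts of the product set are told apart by whether their elements commute with \<open>t0\<close>: those of
\<open>T T\<close> do, those of \<open>yT \<union> Ty\<close> and \<open>y y\<close> do not.\<close>

lemma card_set_mult_insert_noncommuting:
  assumes T: "T \<subseteq> carrier G" "finite T" and y: "y \<in> carrier G" "y \<notin> T"
    and comm: "\<And>s t. s \<in> T \<Longrightarrow> t \<in> T \<Longrightarrow> s \<otimes> t = t \<otimes> s"
    and t0: "t0 \<in> T" "y \<otimes> t0 \<noteq> t0 \<otimes> y"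
  shows "card (insert y T <#> insert y T)
    = card (T <#> T) + card ((\<lambda>t. y \<otimes> t) ` T \<union> (\<lambda>t. t \<otimes> y) ` T) + 1"
proof -
  let ?L = "(\<lambda>t. y \<otimes> t) ` T" and ?R = "(\<lambda>t. t \<otimes> y) ` T"
  have car: "t \<in> carrier G" if "t \<in> T" for t using T that by auto
  have no: "u \<otimes> t0 \<noteq> t0 \<otimes> u" if u: "u \<in> ?L \<union> ?R" for u
  proof
    assume com: "u \<otimes> t0 = t0 \<otimes> u"
    obtain t where t: "t \<in> T" "u = y \<otimes> t \<or> u = t \<otimes> y" using u by auto
    have uc: "u \<in> carrier G" using t y car by auto
    have inv_t: "inv t \<otimes> t0 = t0 \<otimes> inv t" using t t0 car comm by (intro commutes_inv) auto
    have "y = u \<otimes> inv t \<or> y = inv t \<otimes> u"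
      using t y car inv_solve_right[of y u t] inv_solve_left[of y t u] by auto
    moreover have "(u \<otimes> inv t) \<otimes> t0 = t0 \<otimes> (u \<otimes> inv t)" "(inv t \<otimes> u) \<otimes> t0 = t0 \<otimes> (inv t \<otimes> u)"
      using uc t t0 car com inv_t by (auto intro!: commutes_mult)
    ultimately show False using t0 by auto
  qed
  have yes: "u \<otimes> t0 = t0 \<otimes> u" if u: "u \<in> T <#> T" for u
    using u t0 car comm by (auto simp: set_mult_def intro!: commutes_mult)
  have sq: "(y \<otimes> y) \<otimes> t0 \<noteq> t0 \<otimes> (y \<otimes> y)"
  proof
    assume "(y \<otimes> y) \<otimes> t0 = t0 \<otimes> (y \<otimes> y)"
    then have "y [^] (2 :: nat) \<otimes> t0 = t0 \<otimes> y [^] (2 :: nat)" using y by (simp add: numeral_2_eq_2)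
    then have "y \<otimes> t0 = t0 \<otimes> y" by (rule root_commutes) (use y t0 car in auto)
    then show False using t0 by simp
  qed
  have sq': "y \<otimes> y \<notin> ?L \<union> ?R"
  proof
    assume "y \<otimes> y \<in> ?L \<union> ?R"
    then obtain t where "t \<in> T" "y \<otimes> y = y \<otimes> t \<or> y \<otimes> y = t \<otimes> y" by auto
    then have "y = t" using y car by auto
    then show False using \<open>t \<in> T\<close> y by simp
  qed
  have eq: "insert y T <#> insert y T = insert (y \<otimes> y) ((T <#> T) \<union> (?L \<union> ?R))"
    by (auto simp: set_mult_def)
  have fin: "finite (T <#> T)" "finite (?L \<union> ?R)"
    using T by (auto simp: set_mult_def)
  have "(T <#> T) \<inter> (?L \<union> ?R) = {}" using yes no by blast
  then have "card ((T <#> T) \<union> (?L \<union> ?R)) = card (T <#> T) + card (?L \<union> ?R)"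
    using fin by (intro card_Un_disjoint) auto
  moreover have "y \<otimes> y \<notin> (T <#> T) \<union> (?L \<union> ?R)" using sq' yes sq by blast
  moreover have "finite ((T <#> T) \<union> (?L \<union> ?R))" using fin by blast
  ultimately show ?thesis unfolding eq by simp
qed

text \<open>Otherwise \<open>yT = Ty\<close>, and conjugation by \<open>y\<close> maps \<open>T\<close> to itself. It multiplies \<open>t0\<close> by the central
element \<open>z = y t0 y\<inverse> t0\<inverse> \<noteq> 1\<close>, so the whole infinite orbit \<open>t0, t0 z, t0 z^2, \<dots>\<close> would lie in \<open>T\<close>.\<close>

lemma card_translates_noncommuting:
  assumes class2: "nilpotent_of_class G 2"
    and T: "T \<subseteq> carrier G" "finite T" and y: "y \<in> carrier G"
    and t0: "t0 \<in> T" "y \<otimes> t0 \<noteq> t0 \<otimes> y"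
  shows "card T < card ((\<lambda>t. y \<otimes> t) ` T \<union> (\<lambda>t. t \<otimes> y) ` T)"
proof (rule ccontr)
  let ?L = "(\<lambda>t. y \<otimes> t) ` T" and ?R = "(\<lambda>t. t \<otimes> y) ` T"
  have t0c: "t0 \<in> carrier G" using T t0 by auto
  assume "\<not> card T < card (?L \<union> ?R)"
  moreover have "inj_on (\<lambda>t. t \<otimes> y) T" using T y by (auto intro!: inj_onI simp: subset_iff)
  then have "card ?R = card T" by (rule card_image)
  ultimately have "?R = ?L \<union> ?R" using T by (intro card_seteq) auto
  then have LR: "y \<otimes> t \<in> ?R" if "t \<in> T" for t using that by auto
  define z where "z = y \<otimes> t0 \<otimes> inv y \<otimes> inv t0"
  have zc: "z \<in> carrier G" using y t0c by (simp add: z_def)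
  have central: "z \<otimes> u = u \<otimes> z" if "u \<in> carrier G" for u
    unfolding z_def using commutator_central_of_class_2[OF class2 y t0c that] .
  have yt0: "y \<otimes> t0 = t0 \<otimes> z \<otimes> y"
  proof -
    have "z \<otimes> t0 = y \<otimes> t0 \<otimes> inv y" unfolding z_def using y t0c inv_solve_right[of z] by (simp add: m_assoc)
    then have "z \<otimes> t0 \<otimes> y = y \<otimes> t0" using y t0c by (simp add: m_assoc)
    then show ?thesis using central[OF t0c] by simp
  qed
  have "z \<noteq> \<one>" using yt0 t0 t0c y by auto
  have orbit: "t0 \<otimes> z [^] n \<in> T" for n :: nat
  proof (induction n)
    case 0
    then show ?case using t0 t0c by simp
  next
    case (Suc n)
    have zn: "z [^] n \<otimes> y = y \<otimes> z [^] n" using zc y central by (intro commutes_pow) auto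
    obtain t where t: "t \<in> T" "y \<otimes> (t0 \<otimes> z [^] n) = t \<otimes> y" using LR[OF Suc] by auto
    have "y \<otimes> (t0 \<otimes> z [^] n) = t0 \<otimes> z \<otimes> y \<otimes> z [^] n"
      using yt0 y t0c zc by (simp add: m_assoc[symmetric])
    also have "\<dots> = t0 \<otimes> z \<otimes> (z [^] n \<otimes> y)" using zn y t0c zc by (simp add: m_assoc)
    also have "\<dots> = t0 \<otimes> (z \<otimes> z [^] n) \<otimes> y" using y t0c zc by (simp add: m_assoc)
    also have "z \<otimes> z [^] n = z [^] Suc n" using zc by (simp add: nat_pow_Suc2[symmetric] del: nat_pow_Suc)
    finally have "t0 \<otimes> z [^] Suc n = t" using t y t0c zc T by (metis m_closed nat_pow_closed right_cancel subsetD)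
    then show ?case using t by simp
  qed
  have "inj (\<lambda>n :: nat. t0 \<otimes> z [^] n)"
    using pow_inj[OF _ zc \<open>z \<noteq> \<one>\<close>] t0c zc by (auto intro!: injI)
  moreover have "finite (range (\<lambda>n :: nat. t0 \<otimes> z [^] n))"
    using orbit T(2) by (meson finite_subset image_subsetI)
  ultimately show False using finite_imageD infinite_UNIV_nat by blast
qed

text \<open>The relation exhibits \<open>c [^] v\<close> with \<open>v = |j - l|\<close> as a commutator of \<open>y\<close> or of its
inverse. Commutators are central, and with its power \<open>c [^] v\<close> also \<open>c\<close> is central. Powers of \<open>c\<close> can then be moved past \<open>y\<close> and cancelled.\<close>

lemma commutation_from_progression_shift:
  fixes j l :: nat
  assumes class2: "nilpotent_of_class G 2"
    and c: "a \<in> carrier G" "c \<in> carrier G" "y \<in> carrier G" and ac: "a \<otimes> c = c \<otimes> a"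
    and shift: "y \<otimes> (a \<otimes> c [^] j) = (a \<otimes> c [^] l) \<otimes> y" and "j \<noteq> l"
  shows "\<exists>v. 1 \<le> v \<and> v \<le> max j l \<and>
    (a \<otimes> y = y \<otimes> a \<otimes> c [^] v \<or> y \<otimes> a = a \<otimes> y \<otimes> c [^] v)"
proof -
  have pow_a: "c [^] n \<otimes> a = a \<otimes> c [^] n" for n :: nat
    using commutes_pow[OF c(2,1)] ac by simp
  have comm_pow: "c [^] n \<otimes> (a \<otimes> c [^] m) = (a \<otimes> c [^] m) \<otimes> c [^] n" for m n :: nat
  proof -
    have "c [^] n \<otimes> (a \<otimes> c [^] m) = a \<otimes> (c [^] n \<otimes> c [^] m)"
      using pow_a[of n] c by (simp add: m_assoc[symmetric])
    then show ?thesis using c by (simp add: nat_pow_mult add.commute m_assoc)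
  qed
  have central_root: "c \<otimes> u = u \<otimes> c"
    if "p \<in> carrier G" "q \<in> carrier G" "c [^] v = p \<otimes> q \<otimes> inv p \<otimes> inv q" "0 < v"
      "u \<in> carrier G" for p q u and v :: nat
  proof (rule root_commutes)
    show "c [^] v \<otimes> u = u \<otimes> c [^] v"
      unfolding that(3) by (rule commutator_central_of_class_2[OF class2 that(1,2,5)])
  qed (use that c in auto)
  show ?thesis
  proof (cases "j < l")
    case True
    define v where "v = l - j"
    have v: "0 < v" "l = j + v" using True by (auto simp: v_def)
    let ?t = "a \<otimes> c [^] j"
    have t: "?t \<in> carrier G" using c by simp
    have tv: "a \<otimes> c [^] l = c [^] v \<otimes> ?t"
      using c comm_pow[of v j] by (simp add: v(2) nat_pow_mult[symmetric] m_assoc)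
    have "y \<otimes> ?t \<otimes> inv y \<otimes> inv ?t = c [^] v"
    proof -
      have "y \<otimes> ?t \<otimes> inv y = c [^] v \<otimes> ?t"
        unfolding shift tv using c t by (simp add: m_assoc)
      then show ?thesis using c t by (simp add: m_assoc)
    qed
    then have central: "c \<otimes> u = u \<otimes> c" if "u \<in> carrier G" for u
      using central_root[OF c(3) t _ v(1) that] by simp
    have cy: "c [^] n \<otimes> y = y \<otimes> c [^] n" for n :: nat
      using commutes_pow[OF c(2,3)] central c by simp
    have "(y \<otimes> a) \<otimes> c [^] j = a \<otimes> (c [^] l \<otimes> y)" using shift c by (simp add: m_assoc)
    also have "\<dots> = a \<otimes> (y \<otimes> (c [^] v \<otimes> c [^] j))"
      unfolding cy v(2) using c by (simp add: nat_pow_mult add.commute)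
    also have "\<dots> = (a \<otimes> y \<otimes> c [^] v) \<otimes> c [^] j" using c by (simp add: m_assoc)
    finally have "y \<otimes> a = a \<otimes> y \<otimes> c [^] v" using c by simp
    then show ?thesis using v by (intro exI[of _ v]) auto
  next
    case False
    define v where "v = j - l"
    have v: "0 < v" "j = l + v" using False \<open>j \<noteq> l\<close> by (auto simp: v_def)
    let ?t = "a \<otimes> c [^] l"
    have t: "?t \<in> carrier G" using c by simp
    have tv: "a \<otimes> c [^] j = c [^] v \<otimes> ?t"
      using c comm_pow[of v l] by (simp add: v(2) nat_pow_mult[symmetric] m_assoc)
    \<comment> \<open>Conjugating with \<open>inv y\<close> instead of \<open>y\<close> makes the exponent positive.\<close>
    have "inv y \<otimes> ?t \<otimes> inv (inv y) \<otimes> inv ?t = c [^] v"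
    proof -
      have "inv y \<otimes> ?t \<otimes> inv (inv y) = inv y \<otimes> (?t \<otimes> y)" using c t by (simp add: m_assoc)
      also have "\<dots> = inv y \<otimes> (y \<otimes> (c [^] v \<otimes> ?t))" using shift tv by simp
      also have "\<dots> = c [^] v \<otimes> ?t" using c t by (simp add: m_assoc[symmetric])
      finally have "inv y \<otimes> ?t \<otimes> inv (inv y) = c [^] v \<otimes> ?t" .
      then have "inv y \<otimes> ?t \<otimes> inv (inv y) \<otimes> inv ?t = c [^] v \<otimes> ?t \<otimes> inv ?t" by (rule arg_cong)
      also have "\<dots> = c [^] v" using inv_solve_right'[of "c [^] v" "c [^] v \<otimes> ?t" ?t] c t by blast
      finally show ?thesis .
    qed
    then have central: "c \<otimes> u = u \<otimes> c" if "u \<in> carrier G" for u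
      using central_root[OF inv_closed[OF c(3)] t _ v(1) that] by simp
    have cy: "c [^] n \<otimes> y = y \<otimes> c [^] n" for n :: nat
      using commutes_pow[OF c(2,3)] central c by simp
    have "(a \<otimes> y) \<otimes> c [^] l = a \<otimes> (c [^] l \<otimes> y)" using c by (simp add: cy m_assoc)
    also have "\<dots> = y \<otimes> (a \<otimes> c [^] j)" using shift c by (simp add: m_assoc)
    also have "\<dots> = y \<otimes> (a \<otimes> (c [^] v \<otimes> c [^] l))"
      unfolding v(2) using c by (simp add: nat_pow_mult add.commute)
    also have "\<dots> = (y \<otimes> a \<otimes> c [^] v) \<otimes> c [^] l" using c by (simp add: m_assoc)
    finally have "a \<otimes> y = y \<otimes> a \<otimes> c [^] v" using c by simp
    then show ?thesis using v by (intro exI[of _ v]) auto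
  qed
qed

text \<open>The quotient of two different terms of the progression is a positive power of \<open>c\<close>, so \<open>c\<close> itself
commutes with \<open>y\<close>, and then so does \<open>a\<close>.\<close>

lemma commutes_with_progression:
  fixes j l n :: nat
  assumes c: "a \<in> carrier G" "c \<in> carrier G" "y \<in> carrier G" and "j \<noteq> l"
    and com: "(a \<otimes> c [^] j) \<otimes> y = y \<otimes> (a \<otimes> c [^] j)" "(a \<otimes> c [^] l) \<otimes> y = y \<otimes> (a \<otimes> c [^] l)"
  shows "(a \<otimes> c [^] n) \<otimes> y = y \<otimes> (a \<otimes> c [^] n)"
proof -
  have step: "c \<otimes> y = y \<otimes> c"
    if pq: "p < q" and com: "(a \<otimes> c [^] p) \<otimes> y = y \<otimes> (a \<otimes> c [^] p)" "(a \<otimes> c [^] q) \<otimes> y = y \<otimes> (a \<otimes> c [^] q)"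
    for p q :: nat
  proof (rule root_commutes)
    have "c [^] q = c [^] p \<otimes> c [^] (q - p)" using c pq by (simp add: nat_pow_mult)
    then have "c [^] (q - p) = inv (a \<otimes> c [^] p) \<otimes> (a \<otimes> c [^] q)"
      using c inv_solve_left[of "c [^] (q - p)" "a \<otimes> c [^] p" "a \<otimes> c [^] q"] by (simp add: m_assoc)
    then show "c [^] (q - p) \<otimes> y = y \<otimes> c [^] (q - p)"
      using c com commutes_inv[OF _ c(3) com(1)] by (simp add: commutes_mult del: inv_mult_group)
    show "0 < q - p" using pq by simp
  qed (use c in auto)
  have cy: "c \<otimes> y = y \<otimes> c" using step[of j l] step[of l j] com \<open>j \<noteq> l\<close> by (cases "j < l") auto
  then have cn: "c [^] m \<otimes> y = y \<otimes> c [^] m" for m :: nat using c by (simp add: commutes_pow)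
  have "a = (a \<otimes> c [^] j) \<otimes> inv (c [^] j)" using c by (simp add: m_assoc)
  then have "a \<otimes> y = y \<otimes> a"
    using commutes_mult[OF _ _ c(3) com(1) commutes_inv[OF _ c(3) cn[of j]]] c by simp
  then show ?thesis using c cn by (simp add: commutes_mult)
qed

text \<open>Freiman's theorem applies in the subgroup generated by \<open>T\<close>. If its ratio \<open>c\<close> is below the identity,
the progression is read backwards from its last term.\<close>

lemma commuting_small_doubling_in_progression:
  assumes T: "T \<subseteq> carrier G" "finite T" "2 \<le> card T"
    and comm: "comm_group (subgroup_generated G T)"
    and small: "card (T <#> T) + 4 \<le> 3 * card T"
  obtains a c where "a \<in> carrier G" "c \<in> carrier G" "a \<otimes> c = c \<otimes> a" "less \<one> c"
    "\<And>t. t \<in> T \<Longrightarrow> \<exists>j. j + card T \<le> card (T <#> T) \<and> t = a \<otimes> c [^] (j :: nat)"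
proof -
  let ?H = "subgroup_generated G T"
  interpret H: comm_group ?H by (rule comm)
  have sub: "carrier ?H \<subseteq> carrier G" by (rule carrier_subgroup_generated_subset)
  have pow: "u [^]\<^bsub>?H\<^esub> n = u [^] n" for u and n :: nat by (simp add: pow_subgroup_generated)
  have TH: "T \<subseteq> carrier ?H"
    using T by (auto simp: carrier_subgroup_generated intro: generate.incl)
  have mult: "T <#>\<^bsub>?H\<^esub> T = T <#> T" by (simp add: set_mult_def)
  have tf: "torsion_free ?H"
    using torsion_free_carrier sub unfolding torsion_free_def pow by auto
  obtain a c where a: "a \<in> T" and c: "c \<in> carrier ?H"
    and prog: "\<And>t. t \<in> T \<Longrightarrow> \<exists>j :: nat. j + card T \<le> card (T <#> T) \<and> t = a \<otimes> c [^] j"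
    using H.freiman_3k_minus_4[OF tf TH T(2,3)] small unfolding mult pow mult_subgroup_generated
    by blast
  have aH: "a \<in> carrier ?H" using a TH by auto
  have ac: "a \<otimes> c = c \<otimes> a" using H.m_comm[OF aH c] by simp
  have aG: "a \<in> carrier G" and cG: "c \<in> carrier G" using aH c sub by auto
  have "c \<noteq> \<one>"
  proof
    assume "c = \<one>"
    then have "T \<subseteq> {a}" using prog aG by fastforce
    then have "card T \<le> card {a}" by (intro card_mono) auto
    then show False using T by simp
  qed
  then consider "less \<one> c" | "less c \<one>" using totalp_onD[OF less_total] cG by blast
  then show ?thesis
  proof cases
    case 1
    then show ?thesis using that[OF aG cG ac] prog by blast
  next
    case 2
    define N where "N = card (T <#> T) - card T"
    let ?a = "a \<otimes> c [^] N"
    have "less \<one> (inv c)" using mult_left_less[OF 2 cG, of "inv c"] cG by simp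
    moreover have "?a \<otimes> c = c \<otimes> ?a"
      using ac aG cG commutes_pow[OF cG cG] by (intro commutes_mult) auto
    then have "?a \<otimes> inv c = inv c \<otimes> ?a" using aG cG commutes_inv[of c ?a] by simp
    moreover have "\<exists>j. j + card T \<le> card (T <#> T) \<and> t = ?a \<otimes> inv c [^] (j :: nat)" if "t \<in> T" for t
    proof -
      obtain j :: nat where j: "j + card T \<le> card (T <#> T)" "t = a \<otimes> c [^] j" using prog \<open>t \<in> T\<close> by blast
      then have "c [^] N = c [^] j \<otimes> c [^] (N - j)" using cG by (simp add: nat_pow_mult N_def)
      then have "?a \<otimes> inv c [^] (N - j) = t" using aG cG j by (simp add: nat_pow_inv m_assoc)
      then show ?thesis using j by (intro exI[of _ "N - j"]) (auto simp: N_def)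
    qed
    ultimately show ?thesis using that[of ?a "inv c"] aG cG by blast
  qed
qed

text \<open>The count of the square bounds both \<open>T T\<close> and \<open>yT \<union> Ty\<close>. The first bound provides the progression, the second
one two common elements of \<open>yT\<close> and \<open>Ty\<close>.\<close>

lemma small_doubling_abelian_plus_one:
  assumes class2: "nilpotent_of_class G 2"
    and T: "T \<subseteq> carrier G" "finite T" "2 \<le> card T" and y: "y \<in> carrier G" "y \<notin> T"
    and comm: "comm_group (subgroup_generated G T)"
    and t0: "t0 \<in> T" "y \<otimes> t0 \<noteq> t0 \<otimes> y"
    and small: "card (insert y T <#> insert y T) + 2 \<le> 4 * card T"
  shows "\<exists>a\<in>carrier G. \<exists>c\<in>carrier G. \<exists>N v :: nat. less \<one> c \<and>
    N + 2 * card T + 2 \<le> card (insert y T <#> insert y T) \<and>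
    (\<forall>t\<in>T. \<exists>j\<le>N. t = a \<otimes> c [^] j) \<and> 1 \<le> v \<and> v \<le> N \<and>
    (a \<otimes> y = y \<otimes> a \<otimes> c [^] v \<or> y \<otimes> a = a \<otimes> y \<otimes> c [^] v)"
proof -
  let ?L = "(\<lambda>t. y \<otimes> t) ` T" and ?R = "(\<lambda>t. t \<otimes> y) ` T"
  interpret H: comm_group "subgroup_generated G T" by (rule comm)
  have "T \<subseteq> carrier (subgroup_generated G T)"
    using T by (auto simp: carrier_subgroup_generated intro: generate.incl)
  then have com: "s \<otimes> t = t \<otimes> s" if "s \<in> T" "t \<in> T" for s t
    using H.m_comm[of s t] that by auto
  have square: "card (insert y T <#> insert y T) = card (T <#> T) + card (?L \<union> ?R) + 1"
    using T y t0 com by (intro card_set_mult_insert_noncommuting) auto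
  have LR: "card T < card (?L \<union> ?R)"
    using class2 T y t0 by (intro card_translates_noncommuting) auto
  then have "card (T <#> T) + 4 \<le> 3 * card T" using square small by linarith
  then obtain a c where a: "a \<in> carrier G" and c: "c \<in> carrier G" and ac: "a \<otimes> c = c \<otimes> a"
    and pos: "less \<one> c"
    and prog: "\<And>t. t \<in> T \<Longrightarrow> \<exists>j. j + card T \<le> card (T <#> T) \<and> t = a \<otimes> c [^] (j :: nat)"
    using commuting_small_doubling_in_progression[OF T comm] by blast
  define N where "N = card (T <#> T) - card T"
  have prog': "\<exists>j\<le>N. t = a \<otimes> c [^] j" if t: "t \<in> T" for t
  proof -
    obtain j where "j + card T \<le> card (T <#> T)" "t = a \<otimes> c [^] j" using prog[OF t] by blast
    then show ?thesis by (intro exI[of _ j]) (simp add: N_def)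
  qed
  have T2: "2 * card T \<le> card (T <#> T) + 1"
  proof -
    have "torsion_free (subgroup_generated G T)"
      using torsion_free_carrier carrier_subgroup_generated_subset[of T]
      unfolding torsion_free_def pow_subgroup_generated by auto
    moreover have "T \<noteq> {}" using t0 by auto
    ultimately have "2 * card T \<le> card (T <#>\<^bsub>subgroup_generated G T\<^esub> T) + 1"
      using \<open>T \<subseteq> carrier (subgroup_generated G T)\<close> T(2) by (intro H.card_set_mult_self_ge)
    then show ?thesis by (simp add: set_mult_def)
  qed
  have N: "N + 2 * card T + 2 \<le> card (insert y T <#> insert y T)"
    using square LR T2 T(3) by (simp add: N_def)
  have "card ?L + card ?R = card (?L \<union> ?R) + card (?L \<inter> ?R)"
    using T by (intro card_Un_Int) auto
  moreover have "card ?L = card T" "card ?R = card T"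
    using T y by (auto intro!: card_image inj_onI simp: subset_iff)
  ultimately have "\<not> card (?L \<inter> ?R) \<le> Suc 0" using square small T2 by linarith
  moreover have "finite (?L \<inter> ?R)" using T(2) by blast
  ultimately obtain u1 u2 where u: "u1 \<in> ?L \<inter> ?R" "u2 \<in> ?L \<inter> ?R" "u1 \<noteq> u2"
    using card_le_Suc0_iff_eq by metis
  have tr: "\<exists>j\<le>N. \<exists>l\<le>N. u = y \<otimes> (a \<otimes> c [^] j) \<and> u = (a \<otimes> c [^] l) \<otimes> y" if "u \<in> ?L \<inter> ?R" for u
    using that prog' by blast
  obtain j1 l1 where 1: "j1 \<le> N" "l1 \<le> N" "u1 = y \<otimes> (a \<otimes> c [^] j1)" "u1 = (a \<otimes> c [^] l1) \<otimes> y"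
    using tr[OF u(1)] by blast
  obtain j2 l2 where 2: "j2 \<le> N" "l2 \<le> N" "u2 = y \<otimes> (a \<otimes> c [^] j2)" "u2 = (a \<otimes> c [^] l2) \<otimes> y"
    using tr[OF u(2)] by blast
  have "j1 \<noteq> l1 \<or> j2 \<noteq> l2"
  proof (rule ccontr)
    assume "\<not> (j1 \<noteq> l1 \<or> j2 \<noteq> l2)"
    moreover have "j1 \<noteq> j2" using 1 2 u(3) by auto
    ultimately have all: "(a \<otimes> c [^] n) \<otimes> y = y \<otimes> (a \<otimes> c [^] n)" for n :: nat
      using commutes_with_progression[of a c y j1 j2 n] a c y 1 2 by simp
    obtain j :: nat where "t0 = a \<otimes> c [^] j" using prog'[OF t0(1)] by blast
    then show False using all[of j] t0(2) by simp
  qed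
  then obtain v where "1 \<le> v" "v \<le> N" "a \<otimes> y = y \<otimes> a \<otimes> c [^] v \<or> y \<otimes> a = a \<otimes> y \<otimes> c [^] v"
  proof
    assume ne: "j1 \<noteq> l1"
    have "y \<otimes> (a \<otimes> c [^] j1) = a \<otimes> c [^] l1 \<otimes> y" using 1 by simp
    from commutation_from_progression_shift[OF class2 a c y(1) ac this ne] that 1
    show ?thesis by (meson le_trans max.boundedI)
  next
    assume ne: "j2 \<noteq> l2"
    have "y \<otimes> (a \<otimes> c [^] j2) = a \<otimes> c [^] l2 \<otimes> y" using 2 by simp
    from commutation_from_progression_shift[OF class2 a c y(1) ac this ne] that 2
    show ?thesis by (meson le_trans max.boundedI)
  qed
  then show ?thesis using a c pos N prog' by blast
qed

end

theorem theorem2p5: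
  fixes G :: "('a, 'b) monoid_scheme" (structure)
    and less :: "'a \<Rightarrow> 'a \<Rightarrow> bool"  (infix \<open>\<prec>\<close> 50)
    and x :: "nat \<Rightarrow> 'a" and k :: nat and i :: int and S T :: "'a set"
  assumes "ordered_group G (\<prec>)"
    and "nilpotent_of_class G 2"
    and "S = x ` {1..k}" and "S \<subseteq> carrier G" and "card S = k" and "k \<ge> 4"
    and "\<not> comm_group (subgroup_generated G S)"
    and "T = x ` {1..k - 1}"
    and "comm_group (subgroup_generated G T)"
    and "int (card (S <#> S)) = 3 * int k + i"
    and "3 * int k + i \<le> 4 * int k - 6"
    and "i > - int k"
  shows "\<exists>a \<in> carrier G. \<exists>b \<in> carrier G. \<exists>c \<in> carrier G. \<one> \<prec> c \<and>
      S \<subseteq> {a \<otimes> c [^] j | j :: nat. int j \<le> int k + i} \<union> {b} \<and>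
      {a \<otimes> c [^] j | j :: nat. int j \<le> int k + i} \<union> {b}
        \<subseteq> {a \<otimes> c [^] j | j :: nat. int j \<le> 2 * int k - 6} \<union> {b} \<and>
      (\<exists>v :: nat. v \<ge> 1 \<and> int v \<le> int k + i \<and>
        (a \<otimes> b = b \<otimes> a \<otimes> c [^] v \<or> b \<otimes> a = a \<otimes> b \<otimes> c [^] v))"
proof -
  interpret ordered_group G less by (rule assms(1))
  define y where "y = x k"
  have inj: "inj_on x {1..k}" by (rule eq_card_imp_inj_on) (use assms(3,5) in auto)
  have idx: "{1..k} = insert k {1..k - 1}" using assms(6) by auto
  have S: "S = insert y T" unfolding assms(3,8) idx y_def by simp
  have yT: "y \<notin> T"
  proof
    assume "y \<in> T"
    then obtain p where "p \<in> {1..k - 1}" "x k = x p" by (auto simp: assms(8) y_def)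
    moreover have "k \<in> {1..k}" using assms(6) by auto
    ultimately have "k = p" using inj_onD[OF inj, of k p] by auto
    then show False using \<open>p \<in> {1..k - 1}\<close> assms(6) by auto
  qed
  have T: "T \<subseteq> carrier G" "finite T" and y: "y \<in> carrier G" using assms(4,8) S by auto
  have cT: "card T + 1 = k" using assms(5) yT T(2) unfolding S by simp
  have TH: "T \<subseteq> carrier (subgroup_generated G T)"
    using T by (auto simp: carrier_subgroup_generated intro: generate.incl)
  have com: "s \<otimes> t = t \<otimes> s" if "s \<in> T" "t \<in> T" for s t
    using comm_groupE(4)[OF assms(9), of s t] that TH by auto
  have "\<exists>t0\<in>T. y \<otimes> t0 \<noteq> t0 \<otimes> y"
  proof (rule ccontr)
    assume "\<not> ?thesis"
    then have "s \<otimes> t = t \<otimes> s" if "s \<in> S" "t \<in> S" for s t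
      using that com unfolding S by (metis insertE)
    then show False using comm_group_subgroup_generated[OF assms(4)] assms(7) by blast
  qed
  then obtain t0 where t0: "t0 \<in> T" "y \<otimes> t0 \<noteq> t0 \<otimes> y" by blast
  have "card (insert y T <#> insert y T) + 2 \<le> 4 * card T"
    using assms(10,11) cT unfolding S by linarith
  moreover have "2 \<le> card T" using cT assms(6) by linarith
  ultimately obtain a c and N v :: nat where a: "a \<in> carrier G" and c: "c \<in> carrier G" and pos: "less \<one> c"
    and N: "N + 2 * card T + 2 \<le> card (S <#> S)"
    and prog: "\<And>t. t \<in> T \<Longrightarrow> \<exists>j\<le>N. t = a \<otimes> c [^] j" and v: "1 \<le> v" "v \<le> N"
      "a \<otimes> y = y \<otimes> a \<otimes> c [^] v \<or> y \<otimes> a = a \<otimes> y \<otimes> c [^] v"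
    using small_doubling_abelian_plus_one[OF assms(2) T _ y yT assms(9) t0] unfolding S by blast
  have Nk: "int N \<le> int k + i" using N cT assms(10) by linarith
  show ?thesis
  proof (rule bexI[of _ a], rule bexI[of _ y], rule bexI[of _ c], intro conjI exI[of _ v])
    show "S \<subseteq> {a \<otimes> c [^] j | j :: nat. int j \<le> int k + i} \<union> {y}"
    proof
      fix s assume "s \<in> S"
      then consider "s = y" | "s \<in> T" unfolding S by blast
      then show "s \<in> {a \<otimes> c [^] j | j :: nat. int j \<le> int k + i} \<union> {y}"
      proof cases
        case 2
        then obtain j where "j \<le> N" "s = a \<otimes> c [^] j" using prog by blast
        then show ?thesis using Nk by auto
      qed simp
    qed
    show "{a \<otimes> c [^] j | j :: nat. int j \<le> int k + i} \<union> {y}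
        \<subseteq> {a \<otimes> c [^] j | j :: nat. int j \<le> 2 * int k - 6} \<union> {y}"
      using assms(11) by auto
    show "int v \<le> int k + i" using v Nk by linarith
  qed (use a c y pos v in auto)
qed

end
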